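(* There exists a $6$-dimensional subspace $L_{quadr}$ of the ($15$-dimensional) tangent space $T$ to $M^6 \bmod SO(3)$ at $O_6$ and constants $0<c_d\le c_u<+\infty$ such that for every $l\in L_{quadr}$ with $\|l\|=1$, $$-c_u\|l\|\,t^2\le \widetilde D(O_6+tl)-\widetilde D(O_6)\le -c_d\|l\|\,t^2$$ for all sufficiently small $t>0$; while for every tangent vector $l\in T\setminus L_{quadr}$ there are constants $0<c_d'(l)\le c_u'(l)<+\infty$ such that $$-c_u'(l)\,t\le \widetilde D(O_6+tl)-\widetilde D(O_6)\le -c_d'(l)\,t$$ for all sufficiently small $t>0$.
   Context: Let $\mathbb S^2\subset\mathbb R^3$ be the unit sphere centered at the origin. $M$ is the manifold of unoriented straight lines tangent to $\mathbb S^2$; a point of $M$ is represented by a pair $(x,\xi)$ with $x\in\mathbb S^2$ the point of tangency and $\xi$ a unit tangent vector to $\mathbb S^2$ at $x$ giving the direction of the line, with $(x,\xi)$ and $(x,-\xi)$ identified. $M^6$ is the manifold of six-tuples of elements of $M$ (of dimension $18$); $SO(3)$ acts on it diagonally by rotating all the lines, and near $O_6$ the quotient $M^6\bmod SO(3)$ is a smooth $15$-dimensional manifold. For two lines $u,v$, $d_{u,v}$ is the Euclidean distance between them. Let $e_1,e_2,e_3$ be the standard basis of $\mathbb R^3$. $\ell_1^{\pm}$ is the line tangent to $\mathbb S^2$ at $\pm e_1$ with direction $e_3$; $\ell_2^{\pm}$ is the line tangent at $\pm e_2$ with direction $e_1$; $\ell_3^{\pm}$ is the line tangent at $\pm e_3$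 with direction $e_2$. $O_6=(\ell_1^+,\ell_1^-,\ell_2^+,\ell_2^-,\ell_3^+,\ell_3^-)$. For $\mathbf m=(\widetilde\ell_1^+,\widetilde\ell_1^-,\widetilde\ell_2^+,\widetilde\ell_2^-,\widetilde\ell_3^+,\widetilde\ell_3^-)\in M^6$, $$\widetilde D(\mathbf m)=\min_{1\le i<j\le 3,\ \epsilon,\epsilon'\in\{+,-\}} d_{\widetilde\ell_i^{\epsilon},\widetilde\ell_j^{\epsilon'}} ,$$ which is $SO(3)$-invariant and so descends to $M^6\bmod SO(3)$. For a tangent vector $l$ at $O_6$, $O_6+tl\in M^6\bmod SO(3)$ denotes the exponential map (of a fixed smooth Riemannian metric on $M^6\bmod SO(3)$ near $O_6$) applied to $tl$, and $\|\cdot\|$ is a fixed norm on the tangent space. *)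

theory Defs
  imports "HOL-Analysis.Analysis"
begin

definition tangent_line :: "(real^3) \<times> (real^3) \<Rightarrow> (real^3) set" where
  "tangent_line w = {fst w + s *\<^sub>R snd w | s. True}"

definition unit_tangent :: "((real^3) \<times> (real^3)) set" where
  "unit_tangent = {(x, \<xi>). norm x = 1 \<and> norm \<xi> = 1 \<and> x \<bullet> \<xi> = 0}"

text \<open>
  The manifold \<open>M\<close> is the image of \<open>unit_tangent\<close> under \<open>tangent_line\<close>;
  for unit tangent vectors the fibres of this map are exactly the pairs
  \<open>{(x, \<xi>), (x, - \<xi>)}\<close>.  A six-tuple is indexed by \<open>(i, \<epsilon>)\<close> with \<open>i :: 3\<close> and
  \<open>\<epsilon> = True\<close> for the sign \<open>+\<close>.
\<close>

type_synonym index = "3 \<times> bool"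
type_synonym config = "index \<Rightarrow> (real^3) set"
type_synonym frames = "((real^3) \<times> (real^3))^(3 \<times> bool)"

definition unit_frames :: "frames set" where
  "unit_frames = {z. \<forall>k. z $ k \<in> unit_tangent}"

definition config_of :: "frames \<Rightarrow> config" where
  "config_of z = (\<lambda>k. tangent_line (z $ k))"

definition rotate_config :: "real^3^3 \<Rightarrow> config \<Rightarrow> config" where
  "rotate_config R m = (\<lambda>k. (\<lambda>x. R *v x) ` m k)"

definition SO3_orbit :: "config \<Rightarrow> config set" where
  "SO3_orbit m = {rotate_config R m | R. rotation_matrix R}"

text \<open>
  The numeral type \<open>3\<close> is the integers mod 3, so that \<open>i - 1\<close> runs through \<open>3, 1, 2\<close> as \<open>i\<close>
  runs through \<open>1, 2, 3\<close>: the directions at the points \<open>\<plusminus>e\<^sub>1, \<plusminus>e\<^sub>2, \<plusminus>e\<^sub>3\<close> are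
  \<open>e\<^sub>3, e\<^sub>1, e\<^sub>2\<close>.
\<close>

definition O6 :: config where
  "O6 = (\<lambda>(i, \<epsilon>). tangent_line ((if \<epsilon> then 1 else -1) *\<^sub>R axis i 1, axis (i - 1) 1))"

text \<open>
  All unordered pairs \<open>{i, j}\<close> are listed twice below, which is harmless as
  \<open>setdist\<close> is symmetric.  (The order of the type \<open>3\<close> has \<open>3 = 0\<close> as its least
  element.)
\<close>

definition D_tilde :: "config \<Rightarrow> real" where
  "D_tilde m = Min {setdist (m (i, \<epsilon>)) (m (j, \<epsilon>')) | i j \<epsilon> \<epsilon>'. i \<noteq> j}"

definition D_quot :: "config set \<Rightarrow> real" where
  "D_quot c = D_tilde (SOME m. m \<in> c)"

primrec Ck_on :: "nat \<Rightarrow> ('a::real_normed_vector \<Rightarrow> 'b::real_normed_vector) \<Rightarrow> 'a set \<Rightarrow> bool"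
where
  "Ck_on 0 f S = continuous_on S f"
| "Ck_on (Suc n) f S =
     ((\<forall>x\<in>S. f differentiable (at x)) \<and> (\<forall>v. Ck_on n (\<lambda>x. frechet_derivative f (at x) v) S))"

text \<open>Intended for open \<open>S\<close> only.\<close>

definition smooth_on :: "('a::real_normed_vector \<Rightarrow> 'b::real_normed_vector) \<Rightarrow> 'a set \<Rightarrow> bool"
where
  "smooth_on f S \<longleftrightarrow> (\<forall>n. Ck_on n f S)"

definition quot_class :: "frames \<Rightarrow> config set" where
  "quot_class z = SO3_orbit (config_of z)"

text \<open>
  Tangent space at \<open>z\<close> to the orbit of \<open>z\<close> under the diagonal action of \<open>SO(3)\<close>, i.e. the kernel
  of the differential of \<open>quot_class\<close>: the fibres of \<open>quot_class\<close> consist of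
  the orbit of \<open>z\<close> and its images under the finite group of sign changes of the directions.
\<close>

definition orbit_tangent :: "frames \<Rightarrow> frames set" where
  "orbit_tangent z = {(\<chi> k. (cross3 \<omega> (fst (z $ k)), cross3 \<omega> (snd (z $ k)))) | \<omega>. True}"

text \<open>
  A local coordinate system on the 15-dimensional quotient, given by its inverse
  \<open>u \<mapsto> quot_class (\<sigma> u)\<close> together with a smooth lift \<open>\<sigma>\<close>: the composition is injective and its
  differential is injective, so by equality of dimensions it is a diffeomorphism onto an open
  subset of the quotient.  As \<open>quot_class\<close> is a submersion, every coordinate system has
  this form after shrinking its domain.  The tangent space of the quotient is identified with
  \<open>\<real>\<^sup>1\<^sup>5\<close> by the differential.
\<close>

definition quotient_coordinates :: "(real^15) set \<Rightarrow> (real^15 \<Rightarrow> frames) \<Rightarrow> bool" where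
  "quotient_coordinates U \<sigma> \<longleftrightarrow>
     open U \<and> smooth_on \<sigma> U \<and> \<sigma> ` U \<subseteq> unit_frames \<and>
     inj_on (\<lambda>u. quot_class (\<sigma> u)) U \<and>
     (\<forall>u\<in>U. \<forall>h. frechet_derivative \<sigma> (at u) h \<in> orbit_tangent (\<sigma> u) \<longrightarrow> h = 0)"

definition riemannian_metric :: "(real^'n) set \<Rightarrow> (real^'n \<Rightarrow> real^'n^'n) \<Rightarrow> bool" where
  "riemannian_metric U g \<longleftrightarrow>
     smooth_on g U \<and>
     (\<forall>u\<in>U. transpose (g u) = g u \<and> (\<forall>v. v \<noteq> 0 \<longrightarrow> v \<bullet> (g u *v v) > 0))"

definition metric_partial :: "(real^'n \<Rightarrow> real^'n^'n) \<Rightarrow> 'n \<Rightarrow> 'n \<Rightarrow> 'n \<Rightarrow> real^'n \<Rightarrow> real" where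
  "metric_partial g i j k u = frechet_derivative (\<lambda>w. g w $ j $ k) (at u) (axis i 1)"

definition christoffel :: "(real^'n \<Rightarrow> real^'n^'n) \<Rightarrow> real^'n \<Rightarrow> 'n \<Rightarrow> 'n \<Rightarrow> 'n \<Rightarrow> real" where
  "christoffel g u k i j =
     (\<Sum>m\<in>UNIV. matrix_inv (g u) $ k $ m *
        (metric_partial g i j m u + metric_partial g j i m u - metric_partial g m i j u)) / 2"

definition geodesic_acceleration :: "(real^'n \<Rightarrow> real^'n^'n) \<Rightarrow> real^'n \<Rightarrow> real^'n \<Rightarrow> real^'n" where
  "geodesic_acceleration g u v =
     (\<chi> k. - (\<Sum>i\<in>UNIV. \<Sum>j\<in>UNIV. christoffel g u k i j * v $ i * v $ j))"

text \<open>\<open>c\<close> is a geodesic on \<open>[0, 1]\<close> with velocity \<open>c'\<close>.\<close>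

definition geodesic ::
  "(real^'n) set \<Rightarrow> (real^'n \<Rightarrow> real^'n^'n) \<Rightarrow> (real \<Rightarrow> real^'n) \<Rightarrow> (real \<Rightarrow> real^'n) \<Rightarrow> bool"
where
  "geodesic U g c c' \<longleftrightarrow>
     (\<forall>s\<in>{0..1}. c s \<in> U \<and>
        (c has_vector_derivative c' s) (at s within {0..1}) \<and>
        (c' has_vector_derivative geodesic_acceleration g (c s) (c' s)) (at s within {0..1}))"

text \<open>
  The end point of the geodesic on \<open>[0, 1]\<close> with initial point \<open>p\<close> and initial velocity \<open>v\<close>
  (unique if it exists, and existing for small \<open>v\<close>); unspecified if there is none.
\<close>

definition exp_map ::
  "(real^'n) set \<Rightarrow> (real^'n \<Rightarrow> real^'n^'n) \<Rightarrow> real^'n \<Rightarrow> real^'n \<Rightarrow> real^'n"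
where
  "exp_map U g p v = (SOME y. \<exists>c c'. geodesic U g c c' \<and> c 0 = p \<and> c' 0 = v \<and> y = c 1)"

definition is_norm :: "('a::real_vector \<Rightarrow> real) \<Rightarrow> bool" where
  "is_norm N \<longleftrightarrow>
     (\<forall>v. N v \<ge> 0) \<and> (\<forall>v. N v = 0 \<longleftrightarrow> v = 0) \<and>
     (\<forall>a v. N (a *\<^sub>R v) = \<bar>a\<bar> * N v) \<and> (\<forall>v w. N (v + w) \<le> N v + N w)"

end

theory Submission
  imports Defs
begin

text \<open>
Turn the six lines into moving frames: the line \<open>k = (i, \<epsilon>)\<close> touches the sphere at \<open>\<epsilon> X\<^sub>k\<close>, has
direction \<open>\<Xi>\<^sub>k\<close>, and \<open>\<zeta>\<^sub>k = \<Xi>\<^sub>k \<times> X\<^sub>k\<close>.  At the octahedral configuration all these vectors belong to one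
oriented orthonormal basis: \<open>X\<^sub>k = f\<^sub>i\<close>, \<open>\<Xi>\<^sub>k = f\<^bsub>i-1\<^esub>\<close>, \<open>\<zeta>\<^sub>k = f\<^bsub>i+1\<^esub>\<close>.  For \<open>a = (i, \<epsilon>)\<close> and
\<open>b = (i + 1, \<epsilon>')\<close> the distance of the two lines is
\<open>(\<Xi>\<^sub>a \<bullet> \<zeta>\<^sub>b + \<epsilon> \<epsilon>' \<Xi>\<^sub>b \<bullet> \<zeta>\<^sub>a) / sqrt (1 - (\<Xi>\<^sub>a \<bullet> \<Xi>\<^sub>b)\<^sup>2)\<close>.
Both \<open>\<Xi>\<^sub>a \<bullet> \<zeta>\<^sub>b = 1 - |\<Xi>\<^sub>a - \<zeta>\<^sub>b|\<^sup>2 / 2\<close> and \<open>(\<Xi>\<^sub>a \<bullet> \<Xi>\<^sub>b)\<^sup>2\<close> differ from their octahedral values by second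
order terms, so that the first order part of the distance is \<open>\<epsilon> \<epsilon>' \<Xi>\<^sub>b \<bullet> \<zeta>\<^sub>a\<close>
(\<open>distance_formula\<close>).

An infinitesimal motion gives each line an angular velocity.  The first order change of the
distance of \<open>a\<close> and \<open>b\<close> is \<open>\<epsilon> \<epsilon>'\<close> times the difference of the components of the two angular
velocities along \<open>f\<^bsub>i-1\<^esub>\<close> (\<open>distance_first_order\<close>).  The four changes with fixed \<open>i\<close> add up to zero,
so either all of them vanish or one is negative.  All twelve vanish on a space \<open>L\<close>; modulo a
common rotation its elements are the motions which turn each line about its own point of
tangency, with six independent angular speeds \<open>a\<^sub>k\<close> (\<open>angular_on_L\<close>, \<open>dim_L\<close>).  Off \<open>L\<close> the minimum
therefore decreases linearly (\<open>D_tilde_linear_decay\<close>).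

On \<open>L\<close> no individual distance need have a definite second order term, because the first order
part also sees the acceleration of the path.  In the sum over the four sign choices the first
order parts combine to \<open>(\<Xi>\<^bsub>(i+1,+)\<^esub> - \<Xi>\<^bsub>(i+1,-)\<^esub>) \<bullet> (\<zeta>\<^bsub>(i,+)\<^esub> - \<zeta>\<^bsub>(i,-)\<^esub>)\<close>, a product of two small
factors, and the acceleration disappears.  With \<open>\<Delta>\<^sub>i = a\<^bsub>(i,+)\<^esub> - a\<^bsub>(i,-)\<^esub>\<close> the sum changes by
\<open>- (a\<^bsub>(i,+)\<^esub>\<^sup>2 + a\<^bsub>(i,-)\<^esub>\<^sup>2 + \<Delta>\<^sub>i \<Delta>\<^bsub>i+1\<^esub>) t\<^sup>2\<close> to leading order (\<open>distance_second_order\<close>).  No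
positive combination of the three quadratic forms in brackets is positive definite, but they are
never all nonpositive unless every \<open>a\<^sub>k\<close> vanishes: otherwise the products \<open>\<Delta>\<^sub>1 \<Delta>\<^sub>2\<close>, \<open>\<Delta>\<^sub>2 \<Delta>\<^sub>3\<close>,
\<open>\<Delta>\<^sub>3 \<Delta>\<^sub>1\<close> would all be negative, which three real numbers do not permit (\<open>cyclic_definite\<close>).
Compactness makes the decrease uniform.

Of the exponential map only \<open>exp\<^sub>p v = p + v + O(|v|\<^sup>2)\<close> enters (\<open>exp_map_approx\<close>).  Existence of
geodesics comes from Picard iteration, and the expansion from an a priori estimate valid for every
geodesic with small initial velocity.
\<close>

section \<open>Expansions with a quadratic remainder\<close>

text \<open>
Differentiability at \<open>0\<close> with a quadratic instead of a merely sublinear remainder.  The constant in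
the remainder is what makes the quadratic lower bound uniform over all directions in which
the first order change vanishes.
\<close>

definition quad_approx ::
  "('a::real_normed_vector \<Rightarrow> 'b::real_normed_vector) \<Rightarrow> ('a \<Rightarrow> 'b) \<Rightarrow> bool" where
  "quad_approx f f' \<longleftrightarrow> bounded_linear f' \<and>
     (\<exists>C. \<forall>\<^sub>F v in nhds 0. norm (f v - f 0 - f' v) \<le> C * (norm v)\<^sup>2)"

lemma quad_approxI:
  assumes "bounded_linear f'" "\<forall>\<^sub>F v in nhds 0. norm (f v - f 0 - f' v) \<le> C * (norm v)\<^sup>2"
  shows "quad_approx f f'"
  using assms unfolding quad_approx_def by blast

lemma quad_approxE:
  assumes "quad_approx f f'"
  obtains C where "C \<ge> 0" "\<forall>\<^sub>F v in nhds 0. norm (f v - f 0 - f' v) \<le> C * (norm v)\<^sup>2"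
proof -
  obtain C where C: "\<forall>\<^sub>F v in nhds 0. norm (f v - f 0 - f' v) \<le> C * (norm v)\<^sup>2"
    using assms unfolding quad_approx_def by blast
  have "\<forall>\<^sub>F v in nhds 0. norm (f v - f 0 - f' v) \<le> \<bar>C\<bar> * (norm v)\<^sup>2"
    using C by eventually_elim (metis abs_ge_self mult_right_mono order_trans zero_le_power2)
  then show thesis using that[of "\<bar>C\<bar>"] by simp
qed

lemma quad_approx_diff:
  assumes "quad_approx f f'" "quad_approx g g'"
  shows "quad_approx (\<lambda>v. f v - g v) (\<lambda>v. f' v - g' v)"
proof -
  obtain C where C: "\<forall>\<^sub>F v in nhds 0. norm (f v - f 0 - f' v) \<le> C * (norm v)\<^sup>2"
    using assms(1) quad_approxE by blast
  obtain D where D: "\<forall>\<^sub>F v in nhds 0. norm (g v - g 0 - g' v) \<le> D * (norm v)\<^sup>2"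
    using assms(2) quad_approxE by blast
  show ?thesis
  proof (rule quad_approxI)
    show "bounded_linear (\<lambda>v. f' v - g' v)"
      using assms by (simp add: quad_approx_def bounded_linear_sub)
    show "\<forall>\<^sub>F v in nhds 0. norm (f v - g v - (f 0 - g 0) - (f' v - g' v)) \<le> (C + D) * (norm v)\<^sup>2"
      using C D
    proof eventually_elim
      case (elim v)
      have "f v - g v - (f 0 - g 0) - (f' v - g' v) = (f v - f 0 - f' v) - (g v - g 0 - g' v)"
        by simp
      then show ?case using elim norm_triangle_ineq4[of "f v - f 0 - f' v" "g v - g 0 - g' v"]
        by (simp add: algebra_simps)
    qed
  qed
qed

lemma quad_approx_bounded_linear:
  assumes h: "bounded_linear h" and f: "quad_approx f f'"
  shows "quad_approx (\<lambda>v. h (f v)) (\<lambda>v. h (f' v))"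
proof -
  obtain C where C: "\<forall>\<^sub>F v in nhds 0. norm (f v - f 0 - f' v) \<le> C * (norm v)\<^sup>2"
    using f quad_approxE by blast
  obtain K where K: "K \<ge> 0" "\<And>x. norm (h x) \<le> norm x * K"
    using bounded_linear.nonneg_bounded[OF h] by blast
  interpret h: bounded_linear h by (rule h)
  show ?thesis
  proof (rule quad_approxI)
    show "bounded_linear (\<lambda>v. h (f' v))"
      using f by (simp add: quad_approx_def bounded_linear_compose[OF h])
    show "\<forall>\<^sub>F v in nhds 0. norm (h (f v) - h (f 0) - h (f' v)) \<le> (C * K) * (norm v)\<^sup>2"
      using C
    proof eventually_elim
      case (elim v)
      have "norm (h (f v) - h (f 0) - h (f' v)) \<le> norm (f v - f 0 - f' v) * K"
        using K(2)[of "f v - f 0 - f' v"] by (simp add: h.diff)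
      also have "\<dots> \<le> (C * (norm v)\<^sup>2) * K"
        using elim K(1) by (rule mult_right_mono)
      finally show ?case by (simp add: mult_ac)
    qed
  qed
qed

lemma quad_approx_imp_lipschitz:
  assumes "quad_approx f f'"
  obtains C where "C \<ge> 0" "\<forall>\<^sub>F v in nhds 0. norm (f v - f 0) \<le> C * norm v"
proof -
  obtain C where C: "C \<ge> 0" "\<forall>\<^sub>F v in nhds 0. norm (f v - f 0 - f' v) \<le> C * (norm v)\<^sup>2"
    using assms quad_approxE by blast
  obtain K where K: "K \<ge> 0" "\<And>x. norm (f' x) \<le> norm x * K"
    using bounded_linear.nonneg_bounded assms unfolding quad_approx_def by blast
  have "\<forall>\<^sub>F v::'a in nhds 0. norm v < 1"
    using eventually_nhds_in_open[of "ball 0 1" "0::'a"] by simp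
  with C(2) have "\<forall>\<^sub>F v in nhds 0. norm (f v - f 0) \<le> (C + K) * norm v"
  proof eventually_elim
    case (elim v)
    have "norm (f v - f 0) \<le> norm (f v - f 0 - f' v) + norm (f' v)"
      using norm_triangle_ineq[of "f v - f 0 - f' v" "f' v"] by simp
    also have "\<dots> \<le> C * (norm v)\<^sup>2 + norm v * K" using elim K by (intro add_mono) auto
    also have "C * (norm v)\<^sup>2 \<le> C * norm v"
      using elim C(1) by (intro mult_left_mono) (simp_all add: power2_eq_square mult_left_le_one_le)
    finally show ?case by (simp add: algebra_simps)
  qed
  then show thesis using that[of "C + K"] C K by simp
qed

lemma quad_approx_tendsto:
  assumes "quad_approx f f'"
  shows "(f \<longlongrightarrow> f 0) (nhds 0)"
proof -
  obtain C where C: "C \<ge> 0" "\<forall>\<^sub>F v in nhds 0. norm (f v - f 0) \<le> C * norm v"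
    using assms quad_approx_imp_lipschitz by blast
  have "((\<lambda>v. C * norm v) \<longlongrightarrow> C * norm (0::'a)) (nhds (0::'a))"
    by (rule tendsto_mult[OF tendsto_const tendsto_norm[OF filterlim_ident]])
  then have "((\<lambda>v. f v - f 0) \<longlongrightarrow> 0) (nhds 0)"
    by (intro Lim_null_comparison[OF C(2)]) simp
  then show ?thesis by (simp add: Lim_null[symmetric])
qed

text \<open>
The remainder is \<open>B (f v - f 0) (g v - g 0)\<close> plus the contributions of the remainders of \<open>f\<close>
and \<open>g\<close>; the first term is a product of two quantities of size \<open>O(|v|)\<close>.
\<close>

lemma quad_approx_bilinear:
  assumes B: "bounded_bilinear B" and f: "quad_approx f f'" and g: "quad_approx g g'"
  shows "quad_approx (\<lambda>v. B (f v) (g v)) (\<lambda>v. B (f' v) (g 0) + B (f 0) (g' v))"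
proof -
  interpret B: bounded_bilinear B by (rule B)
  obtain C where C: "C \<ge> 0" "\<forall>\<^sub>F v in nhds 0. norm (f v - f 0 - f' v) \<le> C * (norm v)\<^sup>2"
    using f quad_approxE by blast
  obtain D where D: "D \<ge> 0" "\<forall>\<^sub>F v in nhds 0. norm (g v - g 0 - g' v) \<le> D * (norm v)\<^sup>2"
    using g quad_approxE by blast
  obtain C1 where C1: "C1 \<ge> 0" "\<forall>\<^sub>F v in nhds 0. norm (f v - f 0) \<le> C1 * norm v"
    using f quad_approx_imp_lipschitz by blast
  obtain D1 where D1: "D1 \<ge> 0" "\<forall>\<^sub>F v in nhds 0. norm (g v - g 0) \<le> D1 * norm v"
    using g quad_approx_imp_lipschitz by blast
  obtain K where K: "K \<ge> 0" "\<And>a b. norm (B a b) \<le> norm a * norm b * K"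
    using B.nonneg_bounded by blast
  show ?thesis
  proof (rule quad_approxI)
    show "bounded_linear (\<lambda>v. B (f' v) (g 0) + B (f 0) (g' v))"
      using f g unfolding quad_approx_def
      by (intro bounded_linear_add bounded_linear_compose[OF B.bounded_linear_left]
          bounded_linear_compose[OF B.bounded_linear_right]) auto
    show "\<forall>\<^sub>F v in nhds 0. norm (B (f v) (g v) - B (f 0) (g 0) - (B (f' v) (g 0) + B (f 0) (g' v)))
        \<le> (C1 * D1 * K + C * norm (g 0) * K + norm (f 0) * D * K) * (norm v)\<^sup>2"
      using C(2) D(2) C1(2) D1(2)
    proof eventually_elim
      case (elim v)
      have "B (f v) (g v) - B (f 0) (g 0) - (B (f' v) (g 0) + B (f 0) (g' v))
        = B (f v - f 0) (g v - g 0) + B (f v - f 0 - f' v) (g 0) + B (f 0) (g v - g 0 - g' v)"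
        by (simp add: B.diff_left B.diff_right)
      also have "norm \<dots> \<le> norm (B (f v - f 0) (g v - g 0)) + norm (B (f v - f 0 - f' v) (g 0))
          + norm (B (f 0) (g v - g 0 - g' v))"
        by (meson add_mono norm_triangle_ineq order_refl order_trans)
      also have "\<dots> \<le> (C1 * norm v) * (D1 * norm v) * K + (C * (norm v)\<^sup>2) * norm (g 0) * K
          + norm (f 0) * (D * (norm v)\<^sup>2) * K"
        using elim C1 D1 C D K(1)
        by (intro add_mono order_trans[OF K(2)] mult_right_mono mult_mono mult_left_mono) auto
      finally show ?case by (simp add: algebra_simps power2_eq_square)
    qed
  qed
qed

lemma filterlim_scaleR_nhds_0: "filterlim (\<lambda>t. t *\<^sub>R l) (nhds 0) (at_right (0::real))"
  for l :: "'a::real_normed_vector"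
proof -
  have "((\<lambda>t. t *\<^sub>R l) \<longlongrightarrow> 0 *\<^sub>R l) (at_right (0::real))" by (intro tendsto_intros)
  then show ?thesis by simp
qed

lemma quad_approx_along_ray:
  assumes "quad_approx f f'"
  shows "((\<lambda>t. (f (t *\<^sub>R l) - f 0) /\<^sub>R t) \<longlongrightarrow> f' l) (at_right (0::real))"
proof -
  obtain C where C: "C \<ge> 0" "\<forall>\<^sub>F v in nhds 0. norm (f v - f 0 - f' v) \<le> C * (norm v)\<^sup>2"
    using assms quad_approxE by blast
  have lin: "f' (t *\<^sub>R l) = t *\<^sub>R f' l" for t
    using assms by (simp add: quad_approx_def linear_simps)
  have ev: "\<forall>\<^sub>F t in at_right (0::real). norm (f (t *\<^sub>R l) - f 0 - f' (t *\<^sub>R l)) \<le> C * (norm (t *\<^sub>R l))\<^sup>2"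
    using eventually_compose_filterlim[OF C(2) filterlim_scaleR_nhds_0] by simp
  have pos: "\<forall>\<^sub>F t in at_right (0::real). 0 < t" by (rule eventually_at_right_less)
  have "((\<lambda>t. (f (t *\<^sub>R l) - f 0) /\<^sub>R t - f' l) \<longlongrightarrow> 0) (at_right (0::real))"
  proof (rule Lim_null_comparison)
    show "\<forall>\<^sub>F t in at_right (0::real). norm ((f (t *\<^sub>R l) - f 0) /\<^sub>R t - f' l) \<le> C * (norm l)\<^sup>2 * t"
      using ev pos
    proof eventually_elim
      case (elim t)
      have "(f (t *\<^sub>R l) - f 0) /\<^sub>R t - f' l = (f (t *\<^sub>R l) - f 0 - f' (t *\<^sub>R l)) /\<^sub>R t"
        using elim by (simp add: lin scaleR_diff_right)
      then have "norm ((f (t *\<^sub>R l) - f 0) /\<^sub>R t - f' l) = norm (f (t *\<^sub>R l) - f 0 - f' (t *\<^sub>R l)) / t"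
        using elim by (simp add: divide_inverse mult.commute)
      also have "\<dots> \<le> C * (norm (t *\<^sub>R l))\<^sup>2 / t"
        using elim by (intro divide_right_mono) auto
      also have "\<dots> = C * (norm l)\<^sup>2 * t"
        using elim by (simp add: power_mult_distrib power2_eq_square)
      finally show ?case .
    qed
    have "((\<lambda>t. C * (norm l)\<^sup>2 * t) \<longlongrightarrow> C * (norm l)\<^sup>2 * 0) (at_right (0::real))"
      by (intro tendsto_intros)
    then show "((\<lambda>t. C * (norm l)\<^sup>2 * t) \<longlongrightarrow> 0) (at_right (0::real))" by simp
  qed
  then show ?thesis by (simp add: Lim_null[symmetric])
qed

text \<open>
Used to differentiate the identities that define a unit tangent frame.
\<close>

lemma quad_approx_const_imp_zero:
  assumes "quad_approx f f'" "\<forall>\<^sub>F v in nhds 0. f v = c"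
  shows "f' l = 0"
proof -
  have "f 0 = c" using assms(2) eventually_nhds_x_imp_x by fastforce
  moreover have "\<forall>\<^sub>F t in at_right (0::real). f (t *\<^sub>R l) = c"
    using eventually_compose_filterlim[OF assms(2) filterlim_scaleR_nhds_0] by simp
  ultimately have "\<forall>\<^sub>F t in at_right (0::real). (f (t *\<^sub>R l) - f 0) /\<^sub>R t = 0"
    by (auto elim: eventually_mono)
  then have "((\<lambda>t. (f (t *\<^sub>R l) - f 0) /\<^sub>R t) \<longlongrightarrow> 0) (at_right (0::real))"
    by (rule tendsto_eventually)
  with quad_approx_along_ray[OF assms(1), of l] show ?thesis
    by (metis tendsto_unique trivial_limit_at_right_real)
qed

text \<open>
Along rays in the kernel of the differential the function is quadratically small, with one
constant for all such rays.
\<close>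

lemma quad_approx_kernel_bound:
  assumes "quad_approx f f'" "f 0 = 0"
  obtains C where "C \<ge> 0"
    "\<And>l. f' l = 0 \<Longrightarrow> \<forall>\<^sub>F t in at_right (0::real). norm (f (t *\<^sub>R l)) \<le> C * (norm l)\<^sup>2 * t\<^sup>2"
proof -
  obtain C where C: "C \<ge> 0" "\<forall>\<^sub>F v in nhds 0. norm (f v - f 0 - f' v) \<le> C * (norm v)\<^sup>2"
    using assms quad_approxE by blast
  have lin: "f' (t *\<^sub>R l) = t *\<^sub>R f' l" for t l
    using assms by (simp add: quad_approx_def linear_simps)
  show thesis
  proof (rule that[OF C(1)])
    fix l assume "f' l = 0"
    then show "\<forall>\<^sub>F t in at_right (0::real). norm (f (t *\<^sub>R l)) \<le> C * (norm l)\<^sup>2 * t\<^sup>2"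
      using eventually_compose_filterlim[OF C(2) filterlim_scaleR_nhds_0[of l]]
      by (simp add: assms lin power_mult_distrib mult_ac)
  qed
qed

lemma quad_approx_ray_bound:
  assumes "quad_approx f f'" "f 0 = 0"
  obtains C where "C \<ge> 0"
    "\<And>l. \<forall>\<^sub>F t in at_right (0::real). norm (f (t *\<^sub>R l)) \<le> C * norm l * t"
proof -
  obtain C where C: "C \<ge> 0" "\<forall>\<^sub>F v in nhds 0. norm (f v - f 0) \<le> C * norm v"
    using assms quad_approx_imp_lipschitz by blast
  show thesis
  proof (rule that[OF C(1)])
    fix l
    have "\<forall>\<^sub>F t in at_right (0::real). norm (f (t *\<^sub>R l)) \<le> C * norm (t *\<^sub>R l)"
      using eventually_compose_filterlim[OF C(2) filterlim_scaleR_nhds_0[of l]]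
      by (simp add: assms)
    with eventually_at_right_less[of 0]
    show "\<forall>\<^sub>F t in at_right (0::real). norm (f (t *\<^sub>R l)) \<le> C * norm l * t"
      by eventually_elim (simp add: mult_ac)
  qed
qed

section \<open>Lipschitz estimates for the geodesic equation\<close>

text \<open>
Leaving the constant implicit turns the Lipschitz property into a syntactic closure property, by
which the Christoffel symbols can be treated.
\<close>

definition lip :: "'a::metric_space set \<Rightarrow> ('a \<Rightarrow> 'b::metric_space) \<Rightarrow> bool" where
  "lip S f \<longleftrightarrow> (\<exists>K. K-lipschitz_on S f)"

lemma lipI: "K-lipschitz_on S f \<Longrightarrow> lip S f"
  by (auto simp: lip_def)

lemma lip_continuous: "lip S f \<Longrightarrow> continuous_on S f"
  by (auto simp: lip_def intro: lipschitz_on_continuous_on)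

lemma lip_const: "lip S (\<lambda>x. c)"
  by (rule lipI) (rule lipschitz_on_constant)

lemma lip_compose: "lip S f \<Longrightarrow> f ` S \<subseteq> T \<Longrightarrow> lip T g \<Longrightarrow> lip S (\<lambda>x. g (f x))"
  unfolding lip_def 
  by (elim exE, rule exI, rule lipschitz_on_compose2, assumption, rule lipschitz_on_subset)

lemma lip_bounded_linear: "bounded_linear h \<Longrightarrow> lip S f \<Longrightarrow> lip S (\<lambda>x. h (f x))"
  by (rule lip_compose[where T = UNIV])
    (auto simp: lip_def elim: bounded_linear.lipschitz_boundE)

lemma lip_add:
  fixes f g :: "'a::metric_space \<Rightarrow> 'b::real_normed_vector"
  shows "lip S f \<Longrightarrow> lip S g \<Longrightarrow> lip S (\<lambda>x. f x + g x)"
  unfolding lip_def by (elim exE, rule exI, rule lipschitz_on_add)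

lemma lip_diff:
  fixes f g :: "'a::metric_space \<Rightarrow> 'b::real_normed_vector"
  shows "lip S f \<Longrightarrow> lip S g \<Longrightarrow> lip S (\<lambda>x. f x - g x)"
  unfolding lip_def by (elim exE, rule exI, rule lipschitz_on_diff)

lemma lip_minus:
  fixes f :: "'a::metric_space \<Rightarrow> 'b::real_normed_vector"
  shows "lip S f \<Longrightarrow> lip S (\<lambda>x. - f x)"
  unfolding lip_def by (elim exE, rule exI, rule lipschitz_on_minus)

lemma lip_sum:
  fixes f :: "'i \<Rightarrow> 'a::metric_space \<Rightarrow> 'b::real_normed_vector"
  shows "(\<And>i. i \<in> I \<Longrightarrow> lip S (f i)) \<Longrightarrow> lip S (\<lambda>x. \<Sum>i\<in>I. f i x)"
  by (induction I rule: infinite_finite_induct) (auto intro: lip_const lip_add)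

lemma lip_mult:
  fixes f g :: "'a::metric_space \<Rightarrow> real"
  assumes S: "compact S" and f: "lip S f" and g: "lip S g"
  shows "lip S (\<lambda>x. f x * g x)"
proof -
  obtain K M where K: "K-lipschitz_on S f" and M: "M-lipschitz_on S g"
    using f g by (auto simp: lip_def)
  have "bounded (f ` S)" "bounded (g ` S)"
    using S f g by (auto intro!: compact_imp_bounded compact_continuous_image lip_continuous)
  then obtain A B where A: "\<And>x. x \<in> S \<Longrightarrow> \<bar>f x\<bar> \<le> A" and B: "\<And>x. x \<in> S \<Longrightarrow> \<bar>g x\<bar> \<le> B"
    by (auto simp: bounded_iff)
  have "(\<bar>A\<bar> * M + K * \<bar>B\<bar>)-lipschitz_on S (\<lambda>x. f x * g x)"
  proof (rule lipschitz_onI)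
    show "0 \<le> \<bar>A\<bar> * M + K * \<bar>B\<bar>"
      using lipschitz_on_nonneg[OF K] lipschitz_on_nonneg[OF M] by simp
    fix x y assume xy: "x \<in> S" "y \<in> S"
    have "f x * g x - f y * g y = f x * (g x - g y) + (f x - f y) * g y" by (simp add: algebra_simps)
    then have "dist (f x * g x) (f y * g y) \<le> \<bar>f x\<bar> * dist (g x) (g y) + dist (f x) (f y) * \<bar>g y\<bar>"
      by (metis abs_mult abs_triangle_ineq dist_real_def)
    also have "\<dots> \<le> \<bar>A\<bar> * (M * dist x y) + (K * dist x y) * \<bar>B\<bar>"
      using A[OF xy(1)] B[OF xy(2)] lipschitz_onD[OF K xy] lipschitz_onD[OF M xy] lipschitz_on_nonneg[OF K]
      by (intro add_mono mult_mono) auto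
    finally show "dist (f x * g x) (f y * g y) \<le> (\<bar>A\<bar> * M + K * \<bar>B\<bar>) * dist x y"
      by (simp add: algebra_simps)
  qed
  then show ?thesis by (rule lipI)
qed

lemma lip_prod:
  fixes f :: "'i \<Rightarrow> 'a::metric_space \<Rightarrow> real"
  shows "compact S \<Longrightarrow> (\<And>i. i \<in> I \<Longrightarrow> lip S (f i)) \<Longrightarrow> lip S (\<lambda>x. \<Prod>i\<in>I. f i x)"
  by (induction I rule: infinite_finite_induct) (auto intro: lip_const lip_mult)

lemma lip_inverse:
  fixes f :: "'a::metric_space \<Rightarrow> real"
  assumes S: "compact S" and f: "lip S f" and nz: "\<And>x. x \<in> S \<Longrightarrow> f x \<noteq> 0"
  shows "lip S (\<lambda>x. inverse (f x))"
proof (cases "S = {}")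
  case False
  obtain K where K: "K-lipschitz_on S f" using f by (auto simp: lip_def)
  have "continuous_on S (\<lambda>x. \<bar>f x\<bar>)" using lip_continuous[OF f] by (intro continuous_intros)
  then obtain z where z: "z \<in> S" "\<And>x. x \<in> S \<Longrightarrow> \<bar>f z\<bar> \<le> \<bar>f x\<bar>"
    using continuous_attains_inf[OF S False] by blast
  define m where "m = \<bar>f z\<bar>"
  have m: "m > 0" "\<And>x. x \<in> S \<Longrightarrow> m \<le> \<bar>f x\<bar>" using z nz by (auto simp: m_def)
  have "(K / (m * m))-lipschitz_on S (\<lambda>x. inverse (f x))"
  proof (rule lipschitz_onI)
    show "0 \<le> K / (m * m)" using lipschitz_on_nonneg[OF K] m by simp
    fix x y assume xy: "x \<in> S" "y \<in> S"
    have "inverse (f x) - inverse (f y) = (f y - f x) / (f x * f y)"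
      using nz xy by (simp add: field_simps)
    then have "dist (inverse (f x)) (inverse (f y)) = dist (f x) (f y) / (\<bar>f x\<bar> * \<bar>f y\<bar>)"
      by (simp add: dist_real_def abs_mult abs_minus_commute)
    also have "\<dots> \<le> (K * dist x y) / (m * m)"
      using lipschitz_onD[OF K xy] m xy lipschitz_on_nonneg[OF K]
      by (intro frac_le mult_mono) auto
    finally show "dist (inverse (f x)) (inverse (f y)) \<le> K / (m * m) * dist x y" by simp
  qed
  then show ?thesis by (rule lipI)
qed (auto simp: lip_def intro: exI[of _ 0])

lemma lip_vecI:
  fixes f :: "'a::metric_space \<Rightarrow> real^'n"
  assumes "\<And>k. lip S (\<lambda>x. f x $ k)"
  shows "lip S f"
proof -
  obtain K where K: "\<And>k. (K k)-lipschitz_on S (\<lambda>x. f x $ k)" using assms unfolding lip_def by metis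
  have "(\<Sum>k\<in>UNIV. K k)-lipschitz_on S f"
  proof (rule lipschitz_onI)
    show "0 \<le> (\<Sum>k\<in>UNIV. K k)" using lipschitz_on_nonneg[OF K] by (intro sum_nonneg) auto
    fix x y assume xy: "x \<in> S" "y \<in> S"
    have "dist (f x) (f y) \<le> (\<Sum>k\<in>UNIV. \<bar>(f x - f y) $ k\<bar>)"
      unfolding dist_norm by (rule norm_le_l1_cart)
    also have "\<dots> \<le> (\<Sum>k\<in>UNIV. K k * dist x y)"
      using lipschitz_onD[OF K xy] by (intro sum_mono) (simp add: dist_real_def)
    finally show "dist (f x) (f y) \<le> (\<Sum>k\<in>UNIV. K k) * dist x y" by (simp add: sum_distrib_right)
  qed
  then show ?thesis by (rule lipI)
qed

lemma lip_component: "lip S f \<Longrightarrow> lip S (\<lambda>x. f x $ k)" for f :: "'a::metric_space \<Rightarrow> 'b::real_normed_vector^'n"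
  by (rule lip_bounded_linear[OF bounded_linear_vec_nth])

lemma lip_det:
  fixes A :: "'a::metric_space \<Rightarrow> real^'n^'n"
  assumes "compact S" "\<And>i j. lip S (\<lambda>x. A x $ i $ j)"
  shows "lip S (\<lambda>x. det (A x))"
  unfolding det_def by (intro lip_sum lip_mult lip_prod lip_const assms)

lemma matrix_inv_entry:
  fixes A :: "real^'n^'n"
  assumes "det A \<noteq> 0"
  shows "matrix_inv A $ k $ m = det (\<chi> i j. if j = k then axis m 1 $ i else A $ i $ j) * inverse (det A)"
proof -
  have "\<exists>A'. A ** A' = mat 1 \<and> A' ** A = mat 1"
    using assms by (simp add: invertible_det_nz[symmetric] invertible_def)
  then have "A ** matrix_inv A = mat 1"
    unfolding matrix_inv_def by (rule someI2_ex) blast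
  then have "A *v (matrix_inv A *v axis m 1) = axis m 1"
    by (simp add: matrix_vector_mul_assoc)
  then have "matrix_inv A *v axis m 1 = (\<chi> k. det (\<chi> i j. if j = k then axis m 1 $ i else A $ i $ j) / det A)"
    using cramer[OF assms] by blast
  then have "(matrix_inv A *v axis m 1) $ k = det (\<chi> i j. if j = k then axis m 1 $ i else A $ i $ j) / det A"
    by simp
  moreover have "(matrix_inv A *v axis m 1) $ k = matrix_inv A $ k $ m"
    by (simp add: matrix_vector_mult_basis column_def)
  ultimately show ?thesis by (simp add: divide_inverse)
qed

text \<open>
By Cramer's rule the entries of the inverse are quotients of polynomials in the entries.
\<close>

lemma lip_matrix_inv:
  fixes A :: "'a::metric_space \<Rightarrow> real^'n^'n"
  assumes S: "compact S" and A: "\<And>i j. lip S (\<lambda>x. A x $ i $ j)" and nz: "\<And>x. x \<in> S \<Longrightarrow> det (A x) \<noteq> 0"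
  shows "lip S (\<lambda>x. matrix_inv (A x) $ k $ m)"
proof -
  have "lip S (\<lambda>x. (\<chi> i j. if j = k then axis m 1 $ i else A x $ i $ j) $ i $ j)" for i j
    by (cases "j = k") (simp_all add: lip_const A)
  then have "lip S (\<lambda>x. det (\<chi> i j. if j = k then axis m 1 $ i else A x $ i $ j) * inverse (det (A x)))"
    by (intro lip_mult S lip_inverse lip_det A nz)
  then show ?thesis
    unfolding lip_def using matrix_inv_entry[OF nz] by (simp cong: lipschitz_on_cong)
qed

text \<open>
The directional derivatives along a basis are bounded on the compact set, hence so is the operator
norm of the derivative, and the mean value inequality applies by convexity.
\<close>

lemma lip_C1:
  fixes f :: "'a::euclidean_space \<Rightarrow> 'b::real_normed_vector"
  assumes C1: "Ck_on (Suc 0) f U" and S: "compact S" "convex S" "S \<subseteq> U"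
  shows "lip S f"
proof -
  have d: "(f has_derivative frechet_derivative f (at x)) (at x)" if "x \<in> S" for x
    using C1 S(3) that by (auto simp: frechet_derivative_works)
  have c: "continuous_on S (\<lambda>x. frechet_derivative f (at x) v)" for v
    using C1 S(3) by (auto intro: continuous_on_subset)
  have "bounded ((\<lambda>x. frechet_derivative f (at x) v) ` S)" for v
    by (intro compact_imp_bounded compact_continuous_image c S)
  then have "\<exists>B\<ge>0. \<forall>x\<in>S. norm (frechet_derivative f (at x) v) \<le> B" for v
    unfolding bounded_iff by (metis (no_types, lifting) image_eqI norm_ge_zero order_trans abs_ge_self abs_ge_zero)
  then obtain B where B: "\<And>v. 0 \<le> B v" "\<And>v x. x \<in> S \<Longrightarrow> norm (frechet_derivative f (at x) v) \<le> B v"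
    by metis
  have on: "onorm (frechet_derivative f (at x)) \<le> (\<Sum>b\<in>Basis. B b)" if "x \<in> S" for x
    using onorm_componentwise[OF has_derivative_bounded_linear[OF d[OF that]]] sum_mono[of Basis, OF B(2)[OF that]]
    by (rule order_trans)
  have "(\<Sum>b\<in>Basis. B b)-lipschitz_on S f"
  proof (rule lipschitz_onI)
    show "0 \<le> (\<Sum>b\<in>Basis. B b)" by (intro sum_nonneg B)
    fix x y assume "x \<in> S" "y \<in> S"
    then show "dist (f x) (f y) \<le> (\<Sum>b\<in>Basis. B b) * dist x y"
      unfolding dist_norm
      by (intro differentiable_bound[OF S(2) has_derivative_at_withinI[OF d] on])
  qed
  then show ?thesis by (rule lipI)
qed

lemma lip_christoffel:
  fixes g :: "real^'n \<Rightarrow> real^'n^'n"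
  assumes g: "riemannian_metric U g" and S: "compact S" "convex S" "S \<subseteq> U"
  shows "lip S (\<lambda>u. christoffel g u k i j)"
proof -
  have smooth: "Ck_on n g U" for n using g by (auto simp: riemannian_metric_def smooth_on_def)
  have "Ck_on (Suc (Suc 0)) g U" by (rule smooth)
  then have diff: "\<And>x. x \<in> U \<Longrightarrow> g differentiable (at x)"
    and d2: "\<And>v. Ck_on (Suc 0) (\<lambda>x. frechet_derivative g (at x) v) U"
    by (simp_all add: Ck_on.simps(2)[of "Suc 0"] del: Ck_on.simps)
  have "lip S (\<lambda>x. frechet_derivative g (at x) v)" for v
    by (rule lip_C1[OF d2 S])
  then have lp: "lip S (\<lambda>x. frechet_derivative g (at x) (axis i 1) $ j $ k)" for i j k
    by (intro lip_component)
  have pd: "metric_partial g i j k u = frechet_derivative g (at u) (axis i 1) $ j $ k" if "u \<in> S" for u i j k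
  proof -
    have "(g has_derivative frechet_derivative g (at u)) (at u)"
      using diff S(3) that by (auto simp: frechet_derivative_works)
    then have "((\<lambda>w. g w $ j $ k) has_derivative (\<lambda>h. frechet_derivative g (at u) h $ j $ k)) (at u)"
      by (intro bounded_linear.has_derivative[OF bounded_linear_vec_nth])
    from frechet_derivative_at[OF this] show ?thesis
      unfolding metric_partial_def by metis
  qed
  have det: "det (g u) \<noteq> 0" if "u \<in> S" for u
  proof -
    have "v = 0" if "g u *v v = 0" for v
      using g S(3) \<open>u \<in> S\<close> that unfolding riemannian_metric_def
      by (metis inner_zero_right less_irrefl subsetD)
    then show ?thesis
      unfolding invertible_det_nz[symmetric] invertible_left_inverse matrix_left_invertible_ker by blast
  qed
  have ge: "lip S (\<lambda>x. g x $ i $ j)" for i j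
    by (intro lip_component lip_C1[OF smooth S])
  have "lip S (\<lambda>u. (\<Sum>m\<in>UNIV. matrix_inv (g u) $ k $ m *
        (frechet_derivative g (at u) (axis i 1) $ j $ m + frechet_derivative g (at u) (axis j 1) $ i $ m
          - frechet_derivative g (at u) (axis m 1) $ i $ j)) * inverse 2)"
    by (intro lip_mult lip_sum lip_diff lip_add lip_matrix_inv lp ge det lip_const S)
  then show ?thesis
    unfolding lip_def christoffel_def divide_inverse by (simp add: pd cong: lipschitz_on_cong)
qed

lemma geodesic_acceleration_scale:
  "geodesic_acceleration g x (c *\<^sub>R w) = c\<^sup>2 *\<^sub>R geodesic_acceleration g x w"
  by (simp add: geodesic_acceleration_def vec_eq_iff sum_distrib_left power2_eq_square mult_ac)

lemma lip_geodesic_acceleration: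
  fixes g :: "real^'n \<Rightarrow> real^'n^'n"
  assumes g: "riemannian_metric U g" and S: "compact S" "convex S" "S \<subseteq> U" and T: "compact T"
  shows "lip (S \<times> T) (\<lambda>z. geodesic_acceleration g (fst z) (snd z))"
proof (rule lip_vecI)
  fix k
  have fst: "lip (S \<times> T) fst" and snd: "lip (S \<times> T) snd"
    using lip_bounded_linear[OF bounded_linear_fst, of "S \<times> T" "\<lambda>x. x"]
      lip_bounded_linear[OF bounded_linear_snd, of "S \<times> T" "\<lambda>x. x"]
    by (auto intro: lipI lipschitz_on_id)
  have C: "lip (S \<times> T) (\<lambda>z. christoffel g (fst z) k i j)" for i j
    by (rule lip_compose[OF fst _ lip_christoffel[OF g S]]) auto
  show "lip (S \<times> T) (\<lambda>z. geodesic_acceleration g (fst z) (snd z) $ k)"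
    unfolding geodesic_acceleration_def vec_lambda_beta
    by (intro lip_minus lip_sum lip_mult C lip_component snd compact_Times S T)
qed

text \<open>
The acceleration is a quadratic form in the velocity, so it suffices to bound it on unit
velocities, where compactness applies.
\<close>

lemma geodesic_acceleration_bound:
  fixes g :: "real^'n \<Rightarrow> real^'n^'n"
  assumes g: "riemannian_metric U g" and S: "compact S" "convex S" "S \<subseteq> U"
  obtains M where "M > 0" "\<And>x w. x \<in> S \<Longrightarrow> norm (geodesic_acceleration g x w) \<le> M * (norm w)\<^sup>2"
proof -
  have "bounded ((\<lambda>z. geodesic_acceleration g (fst z) (snd z)) ` (S \<times> cball 0 1))"
    by (intro compact_imp_bounded compact_continuous_image lip_continuous lip_geodesic_acceleration[OF g S]
        compact_Times compact_cball S)
  then obtain M where M: "M > 0" "\<And>x w. x \<in> S \<Longrightarrow> norm w \<le> 1 \<Longrightarrow> norm (geodesic_acceleration g x w) \<le> M"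
    unfolding bounded_pos by (force simp: image_iff)
  have "norm (geodesic_acceleration g x w) \<le> M * (norm w)\<^sup>2" if x: "x \<in> S" for x w
  proof (cases "w = 0")
    case True
    then show ?thesis using geodesic_acceleration_scale[of g x 0 0] by simp
  next
    case False
    have "geodesic_acceleration g x w = (norm w)\<^sup>2 *\<^sub>R geodesic_acceleration g x (w /\<^sub>R norm w)"
      using geodesic_acceleration_scale[of g x "norm w" "w /\<^sub>R norm w"] False by simp
    moreover have b: "norm (geodesic_acceleration g x (w /\<^sub>R norm w)) \<le> M"
      using M(2)[OF x, of "w /\<^sub>R norm w"] False by simp
    ultimately show ?thesis
      using mult_left_mono[OF b, of "(norm w)\<^sup>2"] by (simp add: mult.commute[of M])
  qed
  with M(1) show thesis by (rule that)
qed

section \<open>The exponential map to second order\<close>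

text \<open>
The integral operator is a contraction on bounded continuous functions on \<open>\<real>\<close>, where a function on
\<open>[0, 1]\<close> is continued by its values at the end points.  With \<open>K < 1\<close> one application of
Banach's theorem reaches the whole interval.
\<close>

lemma picard:
  fixes H :: "'e::euclidean_space \<Rightarrow> 'e"
  assumes lip: "K-lipschitz_on UNIV H" and K: "K < 1"
  obtains y where "y 0 = y0" "continuous_on {0..1} y"
    "\<And>s. s \<in> {0..1} \<Longrightarrow> (y has_vector_derivative H (y s)) (at s within {0..1})"
proof -
  define F where "F \<phi> s = y0 + integral {0..s} (\<lambda>r. H (\<phi> r))" for \<phi> :: "real \<Rightarrow> 'e" and s :: real
  have cH: "continuous_on S (\<lambda>r. H (\<phi> r))" if "continuous_on S \<phi>" for S and \<phi> :: "real \<Rightarrow> 'e"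
    using lipschitz_on_continuous_on[OF lip] that by (rule continuous_on_compose2) simp
  have cF: "continuous_on (cbox 0 1) (F \<phi>)" if "continuous_on {0..1} \<phi>" for \<phi>
    unfolding F_def[abs_def] using cH[OF that]
    by (auto intro!: continuous_intros indefinite_integral_continuous_1 integrable_continuous_real)
  have "\<exists>g :: real \<Rightarrow>\<^sub>C 'e. (\<forall>x\<in>cbox 0 1. g x = F \<phi> x) \<and> (\<forall>x. g x = F \<phi> (clamp 0 1 x))"
    for \<phi> :: "real \<Rightarrow>\<^sub>C 'e"
    using continuous_on_cbox_bcontfunE[OF cF[of \<phi>]] by (metis continuous_on_apply_bcontfun)
  then obtain T :: "(real \<Rightarrow>\<^sub>C 'e) \<Rightarrow> (real \<Rightarrow>\<^sub>C 'e)" where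
    T: "\<And>\<phi> x. x \<in> cbox 0 1 \<Longrightarrow> T \<phi> x = F \<phi> x" "\<And>\<phi> x. T \<phi> x = F \<phi> (clamp 0 1 x)"
    by metis
  have K0: "0 \<le> K" using lip by (rule lipschitz_on_nonneg)
  have "dist (T \<phi>) (T \<psi>) \<le> K * dist \<phi> \<psi>" for \<phi> \<psi>
  proof (rule dist_bound)
    fix x :: real
    define s where "s = clamp 0 1 x"
    have s: "0 \<le> s" "s \<le> 1" using clamp_in_interval[of 0 1 x] by (auto simp: s_def)
    have i: "(\<lambda>r. H (\<phi> r)) integrable_on {0..s}" for \<phi> :: "real \<Rightarrow>\<^sub>C 'e"
      by (intro integrable_continuous_real cH) auto
    have "dist (T \<phi> x) (T \<psi> x) = norm (integral {0..s} (\<lambda>r. H (\<phi> r) - H (\<psi> r)))"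
      unfolding T(2) s_def[symmetric] F_def by (simp add: dist_norm integral_diff i)
    also have "\<dots> \<le> (K * dist \<phi> \<psi>) * (s - 0)"
    proof (rule integral_bound[OF s(1)])
      show "continuous_on {0..s} (\<lambda>r. H (\<phi> r) - H (\<psi> r))" by (intro continuous_intros cH) auto
      fix r
      have "norm (H (\<phi> r) - H (\<psi> r)) \<le> K * dist (\<phi> r) (\<psi> r)"
        using lipschitz_onD[OF lip, of "\<phi> r" "\<psi> r"] by (simp add: dist_norm)
      also have "\<dots> \<le> K * dist \<phi> \<psi>" using K0 dist_bounded by (intro mult_left_mono)
      finally show "norm (H (\<phi> r) - H (\<psi> r)) \<le> K * dist \<phi> \<psi>" .
    qed
    also have "\<dots> \<le> K * dist \<phi> \<psi>" using s K0 by (simp add: mult_left_le)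
    finally show "dist (T \<phi> x) (T \<psi> x) \<le> K * dist \<phi> \<psi>" .
  qed
  then obtain \<phi> where \<phi>: "T \<phi> = \<phi>" using banach_fix_type[of K T] K0 K by blast
  have eq: "\<phi> s = F \<phi> s" if "s \<in> {0..1}" for s
    using T(1)[of s \<phi>] that by (simp add: \<phi>)
  show thesis
  proof (rule that[of "apply_bcontfun \<phi>"])
    show "\<phi> 0 = y0" using eq[of 0] by (simp add: F_def)
    show "continuous_on {0..1} \<phi>" by simp
    fix s :: real assume s: "s \<in> {0..1}"
    have "(F \<phi> has_vector_derivative 0 + H (\<phi> s)) (at s within {0..1})"
      unfolding F_def[abs_def]
      by (intro has_vector_derivative_add has_vector_derivative_const integral_has_vector_derivative cH s) simp
    then show "(\<phi> has_vector_derivative H (\<phi> s)) (at s within {0..1})"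
      using has_vector_derivative_transform[OF s eq] by simp
  qed
qed

text \<open>
Bounding the derivative only on the open interval suits the continuity argument in
\<open>geodesic_estimate\<close>, where nothing is known yet at the right end point.
\<close>

lemma increment_bound:
  fixes f :: "real \<Rightarrow> 'a::real_normed_vector"
  assumes f': "\<And>s. s \<in> {0..1} \<Longrightarrow> (f has_vector_derivative f' s) (at s within {0..1})"
    and b: "0 \<le> b" "b \<le> 1" and bound: "\<And>s. 0 < s \<Longrightarrow> s < b \<Longrightarrow> norm (f' s) \<le> C"
  shows "norm (f b - f 0) \<le> C * b"
proof (cases "b = 0")
  case False
  then have b0: "0 < b" using b by simp
  have "norm (f b - f 0) \<le> C * b - C * 0"
  proof (rule differentiable_bound_general[OF b0, where f' = f' and \<phi>' = "\<lambda>_. C"])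
    have "continuous_on {0..1} f"
      using f' by (meson continuous_on_eq_continuous_within has_vector_derivative_continuous)
    then show "continuous_on {0..b} f" by (rule continuous_on_subset) (use b in auto)
    show "continuous_on {0..b} (\<lambda>s. C * s)" by (intro continuous_intros)
    fix s assume s: "0 < s" "s < b"
    then show "(f has_vector_derivative f' s) (at s)"
      using f'[of s] b at_within_Icc_at[of 0 s 1] by simp
    show "((\<lambda>s. C * s) has_vector_derivative C) (at s)"
      by (auto intro!: derivative_eq_intros)
    show "norm (f' s) \<le> C" using bound s by blast
  qed
  then show ?thesis by simp
qed simp

text \<open>
Writing the velocity as \<open>\<delta> w\<close> turns the geodesic equation into the first order system \<open>x' = \<delta> w\<close>,
\<open>w' = \<delta> A(x, w)\<close> with the acceleration \<open>A\<close>, which is quadratic in the velocity.  For small \<open>\<delta>\<close> its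
right-hand side has a small Lipschitz constant on a compact set \<open>S\<close> of positions and rescaled
velocities, and solutions do not leave \<open>S\<close> before time \<open>1\<close>.
\<close>

lemma geodesic_exists:
  fixes g :: "real^'n \<Rightarrow> real^'n^'n"
  assumes g: "riemannian_metric U g" and r: "r > 0" "cball p r \<subseteq> U"
  obtains \<delta> where "\<delta> > 0" "\<And>v. norm v \<le> \<delta> \<Longrightarrow> \<exists>c c'. geodesic U g c c' \<and> c 0 = p \<and> c' 0 = v"
proof -
  define S :: "((real^'n) \<times> (real^'n)) set" where "S = cball p r \<times> cball 0 1"
  define G where "G z = (snd z, geodesic_acceleration g (fst z) (snd z))" for z
  have S: "convex S" "closed S" "S \<noteq> {}" "compact S"
    using r unfolding S_def
    by (auto intro!: convex_Times closed_Times compact_Times)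
  have "lip S (\<lambda>z. geodesic_acceleration g (fst z) (snd z))"
    unfolding S_def by (intro lip_geodesic_acceleration[OF g] r) auto
  moreover have "lip S snd"
    using lip_bounded_linear[OF bounded_linear_snd, of S "\<lambda>x. x"] by (auto intro: lipI lipschitz_on_id)
  ultimately obtain K where K: "K-lipschitz_on S G"
    unfolding G_def[abs_def] lip_def using lipschitz_on_Pair by blast
  have "bounded (G ` S)"
    by (intro compact_imp_bounded compact_continuous_image lipschitz_on_continuous_on[OF K] S)
  then obtain B where B: "B > 0" "\<And>z. z \<in> S \<Longrightarrow> norm (G z) \<le> B" unfolding bounded_pos by blast
  have K0: "K \<ge> 0" using K by (rule lipschitz_on_nonneg)
  \<comment> \<open>The first bound makes the system a contraction; the second keeps positions within \<open>r\<close> of \<open>p\<close>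
    and rescaled velocities, which start with norm at most \<open>1/2\<close>, within the unit ball.\<close>
  define \<delta> where "\<delta> = min (1 / (2 * (K + 1))) (min (1/2) r / B)"
  have \<delta>: "\<delta> > 0" using K0 B(1) r by (simp add: \<delta>_def)
  have "\<delta> * (K + 1) \<le> 1 / (2 * (K + 1)) * (K + 1)"
    using K0 by (intro mult_right_mono) (auto simp: \<delta>_def)
  also have "\<dots> < 1" using K0 by (simp add: field_simps)
  finally have \<delta>K: "\<delta> * K < 1" using \<delta> by (simp add: distrib_left)
  have "\<delta> * B \<le> min (1/2) r / B * B"
    using B(1) by (intro mult_right_mono) (auto simp: \<delta>_def)
  then have \<delta>B: "\<delta> * B \<le> 1/2" "\<delta> * B \<le> r" using B(1) by simp_all
  \<comment> \<open>Projecting to the convex set \<open>S\<close> extends the right-hand side to the whole space without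
    increasing its Lipschitz constant.\<close>
  define H where "H z = \<delta> *\<^sub>R G (closest_point S z)" for z
  have mem: "closest_point S z \<in> S" for z using closest_point_in_set[OF S(2,3)] .
  have "(\<delta> * K)-lipschitz_on UNIV H"
  proof (rule lipschitz_onI)
    show "0 \<le> \<delta> * K" using \<delta> K0 by simp
    fix x y
    have "dist (H x) (H y) = \<delta> * dist (G (closest_point S x)) (G (closest_point S y))"
      using \<delta> by (simp add: H_def dist_norm flip: scaleR_diff_right)
    also have "\<dots> \<le> \<delta> * (K * dist x y)"
      using \<delta> K0 lipschitz_onD[OF K mem mem, of x y] closest_point_lipschitz[OF S(1-3), of x y]
      by (intro mult_left_mono) (auto intro: order_trans mult_left_mono)
    finally show "dist (H x) (H y) \<le> \<delta> * K * dist x y" by (simp add: mult.assoc)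
  qed
  note lipH = this
  show thesis
  proof (rule that[of "\<delta> / 2"])
    show "\<delta> / 2 > 0" using \<delta> by simp
    fix v :: "real^'n" assume v: "norm v \<le> \<delta> / 2"
    define y0 where "y0 = (p, v /\<^sub>R \<delta>)"
    obtain y where y: "y 0 = y0" "continuous_on {0..1} y"
      "\<And>s. s \<in> {0..1} \<Longrightarrow> (y has_vector_derivative H (y s)) (at s within {0..1})"
      using picard[OF lipH \<delta>K] by blast
    have yS: "y s \<in> S" if s: "s \<in> {0..1}" for s
    proof -
      have "norm (y s - y 0) \<le> (\<delta> * B) * s"
        by (rule increment_bound[OF y(3)]) (use s \<delta> B(2)[OF mem] in \<open>auto simp: H_def\<close>)
      also have "\<dots> \<le> \<delta> * B" using s \<delta> B(1) by (simp add: mult_left_le)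
      finally have d: "norm (y s - y0) \<le> \<delta> * B" by (simp add: y)
      have "norm (fst (y s) - p) \<le> r"
        using norm_fst_le[of "fst (y s) - p" "snd (y s) - v /\<^sub>R \<delta>"] d \<delta>B
        by (simp add: y0_def minus_prod_def)
      moreover have "norm (snd (y s) - v /\<^sub>R \<delta>) \<le> 1/2"
        using norm_snd_le[of "snd (y s) - v /\<^sub>R \<delta>" "fst (y s) - p"] d \<delta>B
        by (simp add: y0_def minus_prod_def)
      moreover have "norm (v /\<^sub>R \<delta>) \<le> 1/2" using v \<delta> by (simp add: divide_simps)
      ultimately have "norm (fst (y s) - p) \<le> r" "norm (snd (y s)) \<le> 1"
        using norm_triangle_ineq2[of "snd (y s)" "v /\<^sub>R \<delta>"] by linarith+
      then show ?thesis by (simp add: S_def mem_Times_iff dist_norm norm_minus_commute)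
    qed
    define c c' where "c s = fst (y s)" and "c' s = \<delta> *\<^sub>R snd (y s)" for s
    have "geodesic U g c c'"
      unfolding geodesic_def
    proof (intro ballI conjI)
      fix s :: real assume s: "s \<in> {0..1}"
      have "H (y s) = \<delta> *\<^sub>R G (y s)" by (simp add: H_def closest_point_self yS[OF s])
      then have dy: "(y has_vector_derivative \<delta> *\<^sub>R G (y s)) (at s within {0..1})" using y(3)[OF s] by simp
      show "c s \<in> U" using yS[OF s] r(2) by (auto simp: c_def S_def mem_Times_iff)
      show "(c has_vector_derivative c' s) (at s within {0..1})"
        using bounded_linear.has_vector_derivative[OF bounded_linear_fst dy]
        by (simp add: c_def[abs_def] c'_def G_def)
      have "((\<lambda>s. \<delta> *\<^sub>R snd (y s)) has_vector_derivative \<delta> *\<^sub>R snd (\<delta> *\<^sub>R G (y s))) (at s within {0..1})"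
        by (intro bounded_linear.has_vector_derivative[OF bounded_linear_scaleR_right]
            bounded_linear.has_vector_derivative[OF bounded_linear_snd dy])
      then show "(c' has_vector_derivative geodesic_acceleration g (c s) (c' s)) (at s within {0..1})"
        by (simp add: c'_def[abs_def] c_def G_def geodesic_acceleration_scale power2_eq_square)
    qed
    moreover have "c 0 = p" "c' 0 = v" using \<delta> by (simp_all add: c_def c'_def y y0_def)
    ultimately show "\<exists>c c'. geodesic U g c c' \<and> c 0 = p \<and> c' 0 = v" by blast
  qed
qed

text \<open>
A continuity argument: as long as the speed stays below \<open>2 B\<close> and the curve in the ball, the
acceleration is at most \<open>4 M B\<^sup>2\<close>, so that the speed in fact stays below \<open>2 B\<close> with room to spare,
and the bounds cannot be reached for the first time.
\<close>

lemma geodesic_estimate: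
  fixes g :: "real^'n \<Rightarrow> real^'n^'n"
  assumes geo: "geodesic U g c c'" and init: "c 0 = p" "c' 0 = v"
    and M: "M > 0" "\<And>x w. x \<in> cball p r \<Longrightarrow> norm (geodesic_acceleration g x w) \<le> M * (norm w)\<^sup>2"
    and B: "norm v < B" "2 * B < r" "4 * M * B \<le> 1"
  shows "norm (c 1 - p - v) \<le> 4 * M * B\<^sup>2"
proof -
  have B0: "B > 0" using B(1) by (meson norm_ge_zero le_less_trans)
  have dc: "\<And>s. s \<in> {0..1} \<Longrightarrow> (c has_vector_derivative c' s) (at s within {0..1})"
    and dc': "\<And>s. s \<in> {0..1} \<Longrightarrow> (c' has_vector_derivative geodesic_acceleration g (c s) (c' s)) (at s within {0..1})"
    using geo by (auto simp: geodesic_def)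
  have cont: "continuous_on {0..1} c" "continuous_on {0..1} c'"
    using dc dc' by (meson continuous_on_eq_continuous_within has_vector_derivative_continuous)+
  define good where "good s \<longleftrightarrow> norm (c' s) < 2 * B \<and> norm (c s - p) < r" for s
  have vel: "norm (c' b - v) \<le> 4 * M * B\<^sup>2 * b" and pos: "norm (c b - p) \<le> 2 * B * b"
    if b: "0 \<le> b" "b \<le> 1" and gd: "\<And>s. 0 < s \<Longrightarrow> s < b \<Longrightarrow> good s" for b
  proof -
    show "norm (c' b - v) \<le> 4 * M * B\<^sup>2 * b"
      unfolding init(2)[symmetric]
    proof (rule increment_bound[OF dc' b])
      fix s assume s: "0 < s" "s < b"
      have "norm (c' s) \<le> 2 * B" "c s \<in> cball p r"
        using gd[OF s] by (auto simp: good_def dist_norm norm_minus_commute)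
      then have "norm (geodesic_acceleration g (c s) (c' s)) \<le> M * (norm (c' s))\<^sup>2" using M(2) by blast
      also have "\<dots> \<le> M * (2 * B)\<^sup>2"
        using \<open>norm (c' s) \<le> 2 * B\<close> M(1) by (intro mult_left_mono power_mono) auto
      finally show "norm (geodesic_acceleration g (c s) (c' s)) \<le> 4 * M * B\<^sup>2"
        by (simp add: power_mult_distrib)
    qed
    show "norm (c b - p) \<le> 2 * B * b"
      unfolding init(1)[symmetric]
      by (rule increment_bound[OF dc b]) (use gd in \<open>auto simp: good_def intro: less_imp_le\<close>)
  qed
  have good: "good s" if "s \<in> {0..1}" for s
  proof (rule ccontr)
    assume "\<not> good s"
    \<comment> \<open>The first time at which one of the bounds is attained leads to a contradiction.\<close>
    define Bad where "Bad = {s \<in> {0..1}. 2 * B \<le> norm (c' s)} \<union> {s \<in> {0..1}. r \<le> norm (c s - p)}"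
    have "compact Bad" unfolding Bad_def
      by (intro compact_Un; subst compact_eq_bounded_closed;
          intro conjI bounded_subset[OF bounded_closed_interval[of 0 1]] continuous_on_closed_Collect_le
            continuous_intros cont closed_atLeastAtMost) auto
    moreover have "s \<in> Bad" using that \<open>\<not> good s\<close> by (auto simp: Bad_def good_def)
    ultimately obtain b where b: "b \<in> Bad" "\<And>t. t \<in> Bad \<Longrightarrow> b \<le> t"
      using compact_attains_inf[of Bad] by blast
    have b01: "0 \<le> b" "b \<le> 1" using b(1) by (auto simp: Bad_def)
    have gd: "good t" if "0 < t" "t < b" for t
      using b(2)[of t] b01 that by (auto simp: Bad_def good_def not_le[symmetric])
    have "norm (c' b - v) \<le> 4 * M * B\<^sup>2 * b" by (rule vel[OF b01 gd])
    also have "\<dots> \<le> (4 * M * B) * B"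
      using b01 M(1) B0 by (simp add: power2_eq_square mult_left_le)
    also have "\<dots> \<le> 1 * B" using B(3) B0 by (intro mult_right_mono) auto
    finally have "norm (c' b) < 2 * B" using B(1) norm_triangle_ineq2[of "c' b" v] by simp
    moreover have "norm (c b - p) < r"
    proof -
      have "norm (c b - p) \<le> 2 * B * b" by (rule pos[OF b01 gd])
      also have "\<dots> \<le> 2 * B" using b01 B0 by (simp add: mult_left_le)
      finally show ?thesis using B(2) by simp
    qed
    ultimately show False using b(1) by (auto simp: Bad_def)
  qed
  have "norm ((c 1 - 1 *\<^sub>R v) - (c 0 - 0 *\<^sub>R v)) \<le> (4 * M * B\<^sup>2) * 1"
  proof (rule increment_bound[where f' = "\<lambda>s. c' s - v"])
    fix s :: real assume "s \<in> {0..1}"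
    then show "((\<lambda>s. c s - s *\<^sub>R v) has_vector_derivative c' s - v) (at s within {0..1})"
      by (auto intro!: derivative_eq_intros dc)
  next
    fix s :: real assume s: "0 < s" "s < 1"
    have "norm (c' s - v) \<le> 4 * M * B\<^sup>2 * s"
      by (rule vel) (use s in \<open>auto intro: good\<close>)
    also have "\<dots> \<le> 4 * M * B\<^sup>2" using s M(1) by (simp add: mult_left_le)
    finally show "norm (c' s - v) \<le> 4 * M * B\<^sup>2" .
  qed auto
  then show ?thesis by (simp add: init algebra_simps)
qed

text \<open>
The estimate holds for every geodesic with the given initial data, hence for the one that the
choice operator in \<open>exp_map\<close> selects.
\<close>

lemma exp_map_approx:
  fixes g :: "real^'n \<Rightarrow> real^'n^'n"
  assumes g: "riemannian_metric U g" and U: "open U" "p \<in> U"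
  shows "quad_approx (exp_map U g p) (\<lambda>v. v)" "exp_map U g p 0 = p"
    "\<forall>\<^sub>F v in nhds 0. exp_map U g p v \<in> U"
proof -
  obtain r where r: "r > 0" "cball p r \<subseteq> U" using U open_contains_cball by blast
  obtain \<delta> where \<delta>: "\<delta> > 0" "\<And>v. norm v \<le> \<delta> \<Longrightarrow> \<exists>c c'. geodesic U g c c' \<and> c 0 = p \<and> c' 0 = v"
    using geodesic_exists[OF g r] by blast
  obtain M where M: "M > 0" "\<And>x w. x \<in> cball p r \<Longrightarrow> norm (geodesic_acceleration g x w) \<le> M * (norm w)\<^sup>2"
    using geodesic_acceleration_bound[OF g compact_cball convex_cball r(2)] by blast
  define \<rho> where "\<rho> = min \<delta> (min (r / 2) (1 / (4 * M)))"
  have \<rho>: "\<rho> > 0" using \<delta> r M by (simp add: \<rho>_def)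
  have est: "exp_map U g p v \<in> U \<and> norm (exp_map U g p v - p - v) \<le> 4 * M * (norm v)\<^sup>2"
    if v: "norm v < \<rho>" for v
  proof -
    have "\<exists>y c c'. geodesic U g c c' \<and> c 0 = p \<and> c' 0 = v \<and> y = c 1"
      using \<delta>(2)[of v] v by (auto simp: \<rho>_def)
    from someI_ex[OF this] obtain c c' where c: "geodesic U g c c'" "c 0 = p" "c' 0 = v" "exp_map U g p v = c 1"
      unfolding exp_map_def by blast
    have "exp_map U g p v \<in> U" using c by (auto simp: geodesic_def)
    moreover have "norm (c 1 - p - v) \<le> 4 * M * (norm v)\<^sup>2"
    \<comment> \<open>The estimate needs \<open>norm v < B\<close>; letting \<open>B\<close> tend to \<open>norm v\<close> also covers \<open>v = 0\<close>.\<close>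
    proof (rule tendsto_lowerbound)
      show "((\<lambda>B. 4 * M * B\<^sup>2) \<longlongrightarrow> 4 * M * (norm v)\<^sup>2) (at_right (norm v))"
        by (intro tendsto_intros)
      have "\<forall>\<^sub>F B in at_right (norm v). norm v < B \<and> B < \<rho>"
        using v by (auto simp: eventually_at_right)
      then show "\<forall>\<^sub>F B in at_right (norm v). norm (c 1 - p - v) \<le> 4 * M * B\<^sup>2"
      proof eventually_elim
        case (elim B)
        have "B < r / 2" "B < 1 / (4 * M)" using elim by (auto simp: \<rho>_def)
        then have "2 * B < r" "4 * M * B \<le> 1" using M(1) by (auto simp: field_simps)
        then show ?case using geodesic_estimate[OF c(1-3) M] elim by blast
      qed
    qed simp
    ultimately show ?thesis using c(4) by simp
  qed
  show 0: "exp_map U g p 0 = p" using est[of 0] \<rho> by simp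
  have ev: "\<forall>\<^sub>F v::real^'n in nhds 0. norm v < \<rho>"
    using eventually_nhds_in_open[of "ball 0 \<rho>" "0::real^'n"] \<rho> by simp
  show "\<forall>\<^sub>F v in nhds 0. exp_map U g p v \<in> U" using ev by eventually_elim (use est in blast)
  show "quad_approx (exp_map U g p) (\<lambda>v. v)"
  proof (rule quad_approxI)
    show "\<forall>\<^sub>F v in nhds 0. norm (exp_map U g p v - exp_map U g p 0 - v) \<le> 4 * M * (norm v)\<^sup>2"
      using ev by eventually_elim (use est 0 in auto)
  qed (rule bounded_linear_ident)
qed

text \<open>
The derivative is Lipschitz near \<open>p\<close>, so on the ball of radius \<open>|w|\<close> it differs from the derivative
at \<open>p\<close> by \<open>O(|w|)\<close>; the mean value inequality multiplies this by \<open>|w|\<close>.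
\<close>

lemma quad_approx_C2:
  fixes f :: "'a::euclidean_space \<Rightarrow> 'b::real_normed_vector"
  assumes C2: "Ck_on (Suc (Suc 0)) f U" and U: "open U" "p \<in> U"
  shows "quad_approx (\<lambda>w. f (p + w)) (frechet_derivative f (at p))"
proof -
  have diff: "\<And>x. x \<in> U \<Longrightarrow> f differentiable (at x)"
    and d2: "\<And>v. Ck_on (Suc 0) (\<lambda>x. frechet_derivative f (at x) v) U"
    using C2 by (simp_all add: Ck_on.simps(2)[of "Suc 0"] del: Ck_on.simps)
  define D where "D x = frechet_derivative f (at x)" for x
  have D: "(f has_derivative D x) (at x)" if "x \<in> U" for x
    using diff[OF that] by (simp add: frechet_derivative_works D_def)
  obtain r where r: "r > 0" "cball p r \<subseteq> U" using U open_contains_cball by blast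
  have "lip (cball p r) (\<lambda>x. D x b)" for b
    unfolding D_def by (rule lip_C1[OF d2 compact_cball convex_cball r(2)])
  then obtain K where K: "\<And>b. (K b)-lipschitz_on (cball p r) (\<lambda>x. D x b)" unfolding lip_def by metis
  have on: "onorm (\<lambda>h. D x h - D p h) \<le> (\<Sum>b\<in>Basis. K b) * norm (x - p)" if x: "x \<in> cball p r" for x
  proof -
    have "x \<in> U" using x r(2) by blast
    then have "bounded_linear (\<lambda>h. D x h - D p h)"
      by (intro bounded_linear_sub has_derivative_bounded_linear[OF D] U(2))
    then have "onorm (\<lambda>h. D x h - D p h) \<le> (\<Sum>b\<in>Basis. norm (D x b - D p b))"
      by (rule onorm_componentwise)
    also have "\<dots> \<le> (\<Sum>b\<in>Basis. K b * norm (x - p))"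
      using lipschitz_on_normD[OF K x] r(1) by (intro sum_mono) auto
    finally show ?thesis by (simp add: sum_distrib_right)
  qed
  have K0: "0 \<le> (\<Sum>b\<in>Basis. K b)" using lipschitz_on_nonneg[OF K] by (intro sum_nonneg) auto
  show ?thesis
  proof (rule quad_approxI)
    show "bounded_linear (frechet_derivative f (at p))"
      using D[OF U(2)] by (auto simp: D_def intro: has_derivative_bounded_linear)
    have ev: "\<forall>\<^sub>F w::'a in nhds 0. norm w < r"
      using eventually_nhds_in_open[of "ball 0 r" "0::'a"] r by simp
    then show "\<forall>\<^sub>F w in nhds 0. norm (f (p + w) - f (p + 0) - frechet_derivative f (at p) w)
        \<le> (\<Sum>b\<in>Basis. K b) * (norm w)\<^sup>2"
    proof eventually_elim
      case (elim w)
      have "norm (f (p + w) - f p - D p (p + w - p)) \<le> norm (p + w - p) * ((\<Sum>b\<in>Basis. K b) * norm w)"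
      proof (rule differentiable_bound_linearization[where S = "cball p (norm w)"])
        show "p + t *\<^sub>R (p + w - p) \<in> cball p (norm w)" if "t \<in> {0..1}" for t
          using that by (simp add: dist_norm mult_left_le_one_le)
        fix x assume x: "x \<in> cball p (norm w)"
        then have xr: "x \<in> cball p r" using elim by simp
        show "(f has_derivative D x) (at x within cball p (norm w))"
          using D xr r(2) by (blast intro: has_derivative_at_withinI)
        have "onorm (D x - D p) \<le> (\<Sum>b\<in>Basis. K b) * norm (x - p)" using on[OF xr] by (simp add: fun_diff_def)
        also have "\<dots> \<le> (\<Sum>b\<in>Basis. K b) * norm w"
          using x K0 by (intro mult_left_mono) (auto simp: dist_norm norm_minus_commute)
        finally show "onorm (D x - D p) \<le> (\<Sum>b\<in>Basis. K b) * norm w" .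
      qed simp
      then show ?case by (simp add: D_def power2_eq_square mult_ac)
    qed
  qed
qed

lemma quad_approx_compose:
  assumes f: "quad_approx f f'" and h: "quad_approx (\<lambda>w. h (f 0 + w)) h'"
  shows "quad_approx (\<lambda>v. h (f v)) (\<lambda>v. h' (f' v))"
proof -
  obtain A where A: "A \<ge> 0" "\<forall>\<^sub>F v in nhds 0. norm (f v - f 0 - f' v) \<le> A * (norm v)\<^sup>2"
    using f quad_approxE by blast
  obtain L where L: "L \<ge> 0" "\<forall>\<^sub>F v in nhds 0. norm (f v - f 0) \<le> L * norm v"
    using f quad_approx_imp_lipschitz by blast
  obtain C where C: "C \<ge> 0" "\<forall>\<^sub>F w in nhds 0. norm (h (f 0 + w) - h (f 0 + 0) - h' w) \<le> C * (norm w)\<^sup>2"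
    using quad_approxE[OF h] by blast
  have bl: "bounded_linear h'" using h by (simp add: quad_approx_def)
  obtain K where K: "K \<ge> 0" "\<And>x. norm (h' x) \<le> norm x * K"
    using bounded_linear.nonneg_bounded[OF bl] by blast
  have "((\<lambda>v. f v - f 0) \<longlongrightarrow> f 0 - f 0) (nhds 0)"
    using quad_approx_tendsto[OF f] by (intro tendsto_intros)
  then have "filterlim (\<lambda>v. f v - f 0) (nhds 0) (nhds 0)" by simp
  from eventually_compose_filterlim[OF C(2) this]
  have Cf: "\<forall>\<^sub>F v in nhds 0. norm (h (f v) - h (f 0) - h' (f v - f 0)) \<le> C * (norm (f v - f 0))\<^sup>2" by simp
  show ?thesis
  proof (rule quad_approxI)
    show "bounded_linear (\<lambda>v. h' (f' v))"
      using f by (auto simp: quad_approx_def intro: bounded_linear_compose[OF bl])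
    show "\<forall>\<^sub>F v in nhds 0. norm (h (f v) - h (f 0) - h' (f' v)) \<le> (C * L\<^sup>2 + A * K) * (norm v)\<^sup>2"
      using A(2) L(2) Cf
    proof eventually_elim
      case (elim v)
      have "h (f v) - h (f 0) - h' (f' v) = (h (f v) - h (f 0) - h' (f v - f 0)) + h' (f v - f 0 - f' v)"
        using bl by (simp add: linear_simps)
      then have "norm (h (f v) - h (f 0) - h' (f' v))
          \<le> norm (h (f v) - h (f 0) - h' (f v - f 0)) + norm (h' (f v - f 0 - f' v))"
        by (simp only: norm_triangle_ineq)
      also have "\<dots> \<le> C * (L * norm v)\<^sup>2 + (A * (norm v)\<^sup>2) * K"
        using elim A(1) C(1) K(1)
        by (intro add_mono order_trans[OF elim(3)] order_trans[OF K(2)] mult_left_mono mult_right_mono power_mono) auto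
      finally show ?case by (simp add: power_mult_distrib algebra_simps)
    qed
  qed
qed

section \<open>Distances between tangent lines\<close>

text \<open>
Index arithmetic modulo 3, with \<open>i\<close>, \<open>i + 1\<close>, \<open>i - 1\<close> as normal forms.
\<close>

lemma three_arith [simp]:
  fixes i :: 3
  shows "i + 1 + 1 = i - 1" "i - 1 - 1 = i + 1" "i + 1 \<noteq> i" "i - 1 \<noteq> i" "i - 1 \<noteq> i + 1"
    "i \<noteq> i + 1" "i \<noteq> i - 1" "i + 1 \<noteq> i - 1"
  using exhaust_3[of i] by auto

lemma three_cases: "j = i \<or> j = i + 1 \<or> j = i - 1" for i j :: 3
  using exhaust_3[of i] exhaust_3[of j] by force

lemma setdist_isometry:
  assumes "\<And>x y. dist (h x) (h y) = dist x y"
  shows "setdist (h ` A) (h ` B) = setdist A B"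
proof -
  have "{dist x y |x y. x \<in> h ` A \<and> y \<in> h ` B} = (\<lambda>(x, y). dist (h x) (h y)) ` (A \<times> B)"
    by force
  also have "\<dots> = {dist x y |x y. x \<in> A \<and> y \<in> B}"
    unfolding assms by force
  finally have "{dist x y |x y. x \<in> h ` A \<and> y \<in> h ` B} = {dist x y |x y. x \<in> A \<and> y \<in> B}" .
  then show ?thesis by (simp add: setdist_def)
qed

lemma finite_D_tilde_set:
  "finite {setdist (m (i, \<epsilon>)) (m (j, \<epsilon>')) | i j \<epsilon> \<epsilon>'. i \<noteq> j}" for m :: config
proof -
  have "{setdist (m (i, \<epsilon>)) (m (j, \<epsilon>')) | i j \<epsilon> \<epsilon>'. i \<noteq> j}
     \<subseteq> (\<lambda>(a, b). setdist (m a) (m b)) ` UNIV" by auto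
  then show ?thesis by (rule finite_subset) simp
qed

lemma D_tilde_le: "D_tilde m \<le> setdist (m (i, \<epsilon>)) (m (i + 1, \<epsilon>'))"
  unfolding D_tilde_def
proof (rule Min_le[OF finite_D_tilde_set])
  have "i \<noteq> i + 1" by simp
  then show "setdist (m (i, \<epsilon>)) (m (i + 1, \<epsilon>'))
    \<in> {setdist (m (i, \<epsilon>)) (m (j, \<epsilon>')) | i j \<epsilon> \<epsilon>'. i \<noteq> j}" by blast
qed

text \<open>
Two different indices modulo 3 are consecutive in one of the two orders, so that the pairs
\<open>(i, i + 1)\<close> suffice.
\<close>

lemma D_tilde_ge:
  assumes "\<And>i \<epsilon> \<epsilon>'. c \<le> setdist (m (i, \<epsilon>)) (m (i + 1, \<epsilon>'))"
  shows "c \<le> D_tilde m"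
  unfolding D_tilde_def
proof (subst Min_ge_iff[OF finite_D_tilde_set])
  have "(0::3) \<noteq> 1" by simp
  then show "{setdist (m (i, \<epsilon>)) (m (j, \<epsilon>')) | i j \<epsilon> \<epsilon>'. i \<noteq> j} \<noteq> {}" by blast
  have "c \<le> setdist (m (i, \<epsilon>)) (m (j, \<epsilon>'))" if "i \<noteq> j" for i j \<epsilon> \<epsilon>'
  proof -
    from that three_cases[of j i] consider "j = i + 1" | "i = j + 1" by force
    then show ?thesis
      using assms[of i \<epsilon> \<epsilon>'] assms[of j \<epsilon>' \<epsilon>] by cases (auto simp: setdist_sym)
  qed
  then show "\<forall>a\<in>{setdist (m (i, \<epsilon>)) (m (j, \<epsilon>')) | i j \<epsilon> \<epsilon>'. i \<noteq> j}. c \<le> a" by blast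
qed

lemma D_tilde_rotate:
  assumes "rotation_matrix R"
  shows "D_tilde (rotate_config R m) = D_tilde m"
proof -
  have "orthogonal_transformation ((*v) R)"
    using assms by (simp add: rotation_matrix_def orthogonal_transformation_matrix)
  then have "dist (R *v x) (R *v y) = dist x y" for x y
    by (metis orthogonal_transformation_isometry)
  then show ?thesis
    by (simp add: D_tilde_def rotate_config_def setdist_isometry)
qed

lemma D_quot_quot_class: "D_quot (quot_class z) = D_tilde (config_of z)"
proof -
  have "rotate_config (mat 1) (config_of z) \<in> quot_class z"
    unfolding quot_class_def SO3_orbit_def
    by (auto simp: rotation_matrix_def orthogonal_matrix_id)
  then have "(SOME m. m \<in> quot_class z) \<in> quot_class z" by (rule someI[of "\<lambda>m. m \<in> quot_class z"])
  then show ?thesis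
    by (auto simp: D_quot_def quot_class_def SO3_orbit_def D_tilde_rotate)
qed

lemma tangent_line_scale: "s \<noteq> 0 \<Longrightarrow> tangent_line (x, s *\<^sub>R \<xi>) = tangent_line (x, \<xi>)"
proof -
  assume "s \<noteq> 0"
  then have "\<exists>r'. x + r *\<^sub>R \<xi> = x + r' *\<^sub>R s *\<^sub>R \<xi>" for r
    by (intro exI[of _ "r / s"]) simp
  then show ?thesis unfolding tangent_line_def by fastforce
qed

lemma tangent_line_rotate: "(*v) R ` tangent_line (x, \<xi>) = tangent_line (R *v x, R *v \<xi>)"
proof -
  have "R *v (x + s *\<^sub>R \<xi>) = R *v x + s *\<^sub>R (R *v \<xi>)" for s
    by (simp add: matrix_vector_right_distrib matrix_vector_mult_scaleR)
  then show ?thesis unfolding tangent_line_def by (force simp: image_iff)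
qed

lemma tangent_line_inject:
  assumes "(x, \<xi>) \<in> unit_tangent" "(y, \<eta>) \<in> unit_tangent"
    and eq: "tangent_line (x, \<xi>) = tangent_line (y, \<eta>)"
  shows "x = y \<and> (\<eta> = \<xi> \<or> \<eta> = - \<xi>)"
proof -
  have x: "x \<bullet> x = 1" "\<xi> \<bullet> \<xi> = 1" "x \<bullet> \<xi> = 0" "y \<bullet> y = 1" "\<eta> \<bullet> \<eta> = 1"
    using assms by (auto simp: unit_tangent_def dot_square_norm)
  have "y \<in> tangent_line (y, \<eta>)" unfolding tangent_line_def by (auto intro: exI[of _ 0])
  then have "y \<in> tangent_line (x, \<xi>)" by (simp add: eq)
  then obtain t where t: "y = x + t *\<^sub>R \<xi>" unfolding tangent_line_def by auto
  have "y \<bullet> y = 1 + t * t"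
    unfolding t by (simp add: inner_add_left inner_add_right x inner_commute[of \<xi> x])
  then have "t = 0" using x by simp
  then have xy: "x = y" using t by simp
  have "y + \<eta> \<in> tangent_line (y, \<eta>)" unfolding tangent_line_def by (auto intro: exI[of _ 1])
  then have "y + \<eta> \<in> tangent_line (x, \<xi>)" by (simp add: eq)
  then obtain s where "y + \<eta> = x + s *\<^sub>R \<xi>" unfolding tangent_line_def by auto
  then have s: "\<eta> = s *\<^sub>R \<xi>" using xy by simp
  then have "s * s = 1" using x by simp
  then have "s = 1 \<or> s = -1" using square_eq_1_iff by blast
  then show ?thesis using xy s by auto
qed

lemma norm_cross_unit:
  assumes "norm \<xi> = 1" "norm \<eta> = 1"
  shows "norm (cross3 \<xi> \<eta>) = sqrt (1 - (\<xi> \<bullet> \<eta>)\<^sup>2)"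
  using norm_cross_dot[of \<xi> \<eta>] assms by (simp add: real_sqrt_unique[symmetric] algebra_simps)

text \<open>
The projection of any connecting vector to the common normal \<open>n = \<xi> \<times> \<eta>\<close> is the same, which gives the
lower bound; it is attained by the common perpendicular, whose feet are computed explicitly.
\<close>

lemma setdist_tangent_lines:
  assumes "norm \<xi> = 1" "norm \<eta> = 1" and c: "(\<xi> \<bullet> \<eta>)\<^sup>2 < 1"
  shows "setdist (tangent_line (x, \<xi>)) (tangent_line (y, \<eta>))
    = \<bar>(x - y) \<bullet> cross3 \<xi> \<eta>\<bar> / sqrt (1 - (\<xi> \<bullet> \<eta>)\<^sup>2)" (is "?d = ?r")
proof -
  define n where "n = cross3 \<xi> \<eta>"
  define c where "c = \<xi> \<bullet> \<eta>"
  define w where "w = x - y"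
  have u: "\<xi> \<bullet> \<xi> = 1" "\<eta> \<bullet> \<eta> = 1" using assms by (auto simp: dot_square_norm)
  have cc: "1 - c\<^sup>2 > 0" using assms by (simp add: c_def)
  have nn: "norm n = sqrt (1 - c\<^sup>2)" unfolding n_def c_def using assms norm_cross_unit by blast
  have n0: "norm n > 0" using cc nn by simp
  have on: "\<xi> \<bullet> n = 0" "\<eta> \<bullet> n = 0" by (simp_all add: n_def dot_cross_self)
  have wn: "(x + s *\<^sub>R \<xi> - (y + t *\<^sub>R \<eta>)) \<bullet> n = w \<bullet> n" for s t
    by (simp add: w_def inner_diff_left inner_add_left on)
  have ge: "?r \<le> ?d"
  proof (rule le_setdistI)
    show "tangent_line (x, \<xi>) \<noteq> {}" "tangent_line (y, \<eta>) \<noteq> {}" by (auto simp: tangent_line_def)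
    fix p q assume "p \<in> tangent_line (x, \<xi>)" "q \<in> tangent_line (y, \<eta>)"
    then obtain s t where "p = x + s *\<^sub>R \<xi>" "q = y + t *\<^sub>R \<eta>" by (auto simp: tangent_line_def)
    then have "\<bar>w \<bullet> n\<bar> \<le> dist p q * norm n"
      using Cauchy_Schwarz_ineq2[of "p - q" n] wn[of s t] by (simp add: dist_norm)
    then show "?r \<le> dist p q"
      using n0 by (simp add: n_def[symmetric] c_def[symmetric] w_def[symmetric] nn[symmetric] divide_simps)
  qed
  \<comment> \<open>The solution of the two linear equations which say that the connecting vector is orthogonal
    to both lines.\<close>
  define s where "s = (c * (w \<bullet> \<eta>) - w \<bullet> \<xi>) / (1 - c\<^sup>2)"
  define t where "t = (w \<bullet> \<eta> - c * (w \<bullet> \<xi>)) / (1 - c\<^sup>2)"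
  define v where "v = x + s *\<^sub>R \<xi> - (y + t *\<^sub>R \<eta>)"
  have "v \<bullet> \<xi> = w \<bullet> \<xi> + s - t * c" "v \<bullet> \<eta> = w \<bullet> \<eta> + s * c - t"
    by (simp_all add: v_def w_def inner_diff_left inner_add_left u c_def inner_commute[of \<eta> \<xi>])
  moreover have "w \<bullet> \<xi> + s - t * c = 0" "w \<bullet> \<eta> + s * c - t = 0"
    using cc unfolding s_def t_def by (simp_all add: field_simps power2_eq_square)
  ultimately have v0: "v \<bullet> \<xi> = 0" "v \<bullet> \<eta> = 0" by simp_all
  have "cross3 v n = 0"
    unfolding n_def Lagrange using v0 by (simp add: inner_commute)
  then have "(v \<bullet> n)\<^sup>2 = (norm v * norm n)\<^sup>2" using norm_cross_dot[of v n] by simp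
  then have "sqrt ((v \<bullet> n)\<^sup>2) = sqrt ((norm v * norm n)\<^sup>2)" by (rule arg_cong)
  then have "\<bar>v \<bullet> n\<bar> = norm v * norm n" by (simp only: real_sqrt_abs abs_mult abs_norm_cancel)
  then have "norm v = ?r"
    using n0 wn[of s t] by (simp add: n_def[symmetric] c_def[symmetric] w_def[symmetric] v_def[symmetric] nn[symmetric])
  moreover have "?d \<le> dist (x + s *\<^sub>R \<xi>) (y + t *\<^sub>R \<eta>)"
    by (rule setdist_le_dist) (auto simp: tangent_line_def)
  ultimately have "?d \<le> ?r" by (simp add: v_def dist_norm)
  with ge show ?thesis by simp
qed

text \<open>
The triple product in the distance is rewritten by the third frame vectors \<open>\<eta> \<times> Y\<close> and \<open>\<xi> \<times> X\<close>.
In this form, near the octahedral configuration, the first term is a cosine close to \<open>1\<close> and the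
second term is small.
\<close>

lemma setdist_opposite_tangent_lines:
  assumes "norm \<xi> = 1" "norm \<eta> = 1" "(\<xi> \<bullet> \<eta>)\<^sup>2 < 1" "\<bar>\<epsilon>\<bar> = 1" "\<bar>\<delta>\<bar> = 1"
  shows "setdist (tangent_line (\<epsilon> *\<^sub>R X, \<xi>)) (tangent_line (\<delta> *\<^sub>R Y, \<eta>))
    = \<bar>\<xi> \<bullet> cross3 \<eta> Y + \<epsilon> * \<delta> * (\<eta> \<bullet> cross3 \<xi> X)\<bar> / sqrt (1 - (\<xi> \<bullet> \<eta>)\<^sup>2)"
proof -
  have "(\<epsilon> *\<^sub>R X - \<delta> *\<^sub>R Y) \<bullet> cross3 \<xi> \<eta> = - \<epsilon> * (\<eta> \<bullet> cross3 \<xi> X) - \<delta> * (\<xi> \<bullet> cross3 \<eta> Y)"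
    by (simp add: cross3_simps)
  moreover have "(\<epsilon> = 1 \<or> \<epsilon> = -1) \<and> (\<delta> = 1 \<or> \<delta> = -1)" using assms by linarith
  ultimately have "\<bar>(\<epsilon> *\<^sub>R X - \<delta> *\<^sub>R Y) \<bullet> cross3 \<xi> \<eta>\<bar> = \<bar>\<xi> \<bullet> cross3 \<eta> Y + \<epsilon> * \<delta> * (\<eta> \<bullet> cross3 \<xi> X)\<bar>"
    by auto
  then show ?thesis using setdist_tangent_lines[OF assms(1-3)] by simp
qed

section \<open>Configurations near the octahedral one\<close>

abbreviation sgn_of :: "bool \<Rightarrow> real" where
  "sgn_of \<epsilon> \<equiv> if \<epsilon> then 1 else -1"

lemma bounded_bilinear_cross3: "bounded_bilinear cross3"
  using bilinear_cross bilinear_conv_bounded_bilinear by blast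

lemma cross3_derivation:
  "cross3 (cross3 w a) b + cross3 a (cross3 w b) = cross3 w (cross3 a b)"
proof -
  have "cross3 (cross3 w a) b = - cross3 b (cross3 w a)" "cross3 b w = - cross3 w b"
    using cross_skew by blast+
  moreover have "cross3 a (cross3 b w) = - cross3 a (cross3 w b)"
    using calculation(2) by simp
  ultimately show ?thesis using Jacobi[of w a b] by (simp add: add_eq_0_iff)
qed

text \<open>
If no difference \<open>a i - b i\<close> vanishes, then the hypothesis makes the product of any two cyclically
consecutive differences negative, so the differences would have to alternate in sign around a
cycle of length three.  If one difference vanishes, the vanishing propagates around the cycle.
\<close>

lemma cyclic_definite:
  fixes a b :: "3 \<Rightarrow> real"
  assumes nonpos: "\<And>i. (a i)\<^sup>2 + (b i)\<^sup>2 + (a i - b i) * (a (i + 1) - b (i + 1)) \<le> 0"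
  shows "a j = 0 \<and> b j = 0"
proof -
  define \<Delta> where "\<Delta> i = a i - b i" for i
  have np: "(a i)\<^sup>2 + (b i)\<^sup>2 \<le> - (\<Delta> i * \<Delta> (i + 1))" for i
    using nonpos[of i] by (simp add: \<Delta>_def)
  have zero: "a i = 0 \<and> b i = 0" if "\<Delta> i * \<Delta> (i + 1) = 0" for i
    using np[of i] that by (simp add: sum_power2_le_zero_iff)
  \<comment> \<open>Otherwise the three differences would alternate in sign around an odd cycle.\<close>
  have "\<exists>i. \<Delta> i = 0"
  proof (rule ccontr)
    assume "\<nexists>i. \<Delta> i = 0"
    then have ne: "\<Delta> i \<noteq> 0" for i by blast
    have neg: "\<Delta> i * \<Delta> (i + 1) < 0" for i
    proof -
      have "a i \<noteq> 0 \<or> b i \<noteq> 0" using ne[of i] by (auto simp: \<Delta>_def)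
      then have "(a i)\<^sup>2 + (b i)\<^sup>2 > 0" by (simp add: sum_power2_gt_zero_iff)
      then show ?thesis using np[of i] by linarith
    qed
    show False using neg[of j] neg[of "j + 1"] neg[of "j - 1"]
      by (auto simp: mult_less_0_iff)
  qed
  then obtain i where i: "\<Delta> i = 0" by blast
  have 0: "a i = 0 \<and> b i = 0" using zero i by simp
  have 1: "a (i - 1) = 0 \<and> b (i - 1) = 0" using zero[of "i - 1"] i by simp
  then have 2: "a (i + 1) = 0 \<and> b (i + 1) = 0" using zero[of "i + 1"] by (simp add: \<Delta>_def)
  show ?thesis using 0 1 2 three_cases[of j i] by auto
qed

lemma uniform_over_finite_type:
  fixes P :: "'k::finite \<Rightarrow> real \<Rightarrow> bool"
  assumes "\<And>k. \<exists>C\<ge>0. P k C" and mono: "\<And>k C C'. P k C \<Longrightarrow> C \<le> C' \<Longrightarrow> P k C'"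
  shows "\<exists>C\<ge>0. \<forall>k. P k C"
proof -
  obtain C where C: "\<And>k. 0 \<le> C k \<and> P k (C k)" using assms(1) by metis
  have "C k \<le> sum C UNIV" for k by (rule member_le_sum) (use C in auto)
  then have "P k (sum C UNIV)" for k using C mono by blast
  moreover have "0 \<le> sum C UNIV" using C by (intro sum_nonneg) auto
  ultimately show ?thesis by blast
qed

text \<open>
A family of configurations, described by frames, that passes through an octahedral configuration
at \<open>0\<close> and is known to first order, with a quadratic remainder.  The contact point of the line \<open>k\<close> is \<open>X k\<close> up to the sign
carried by \<open>k\<close>, so that opposite lines have the same frame at \<open>0\<close>.  The assumption \<open>transversal\<close>
says that no nonzero direction of the family is an infinitesimal common rotation.
\<close>

locale octahedral_family =
  fixes f :: "3 \<Rightarrow> real^3"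
    and X \<Xi> X' \<Xi>' :: "index \<Rightarrow> 'a::euclidean_space \<Rightarrow> real^3"
  assumes f_inner: "f i \<bullet> f j = (if i = j then 1 else 0)"
    and f_cross: "cross3 (f i) (f (i + 1)) = f (i - 1)"
    and X_approx: "quad_approx (X k) (X' k)"
    and \<Xi>_approx: "quad_approx (\<Xi> k) (\<Xi>' k)"
    and X_0: "X k 0 = f (fst k)"
    and \<Xi>_0: "\<Xi> k 0 = f (fst k - 1)"
    and frames: "\<forall>\<^sub>F v in nhds 0. \<forall>k. norm (X k v) = 1 \<and> norm (\<Xi> k v) = 1 \<and> X k v \<bullet> \<Xi> k v = 0"
    and transversal:
      "(\<And>k. X' k l = cross3 \<omega> (f (fst k)) \<and> \<Xi>' k l = cross3 \<omega> (f (fst k - 1))) \<Longrightarrow> l = 0"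
    and dimension: "DIM('a) = 15"
begin

definition lines :: "'a \<Rightarrow> config" where
  "lines v = (\<lambda>k. tangent_line (sgn_of (snd k) *\<^sub>R X k v, \<Xi> k v))"

definition \<zeta> :: "index \<Rightarrow> 'a \<Rightarrow> real^3" where
  "\<zeta> k v = cross3 (\<Xi> k v) (X k v)"

text \<open>
The angular velocity of the frame \<open>k\<close> under the infinitesimal motion \<open>l\<close>, given by its coordinates in
the basis \<open>f\<close>; the defining property is \<open>infinitesimal_rotation\<close>.
\<close>

definition angular :: "index \<Rightarrow> 'a \<Rightarrow> real^3" where
  "angular k l = (- (\<Xi>' k l \<bullet> f (fst k + 1))) *\<^sub>R f (fst k) + (\<Xi>' k l \<bullet> f (fst k)) *\<^sub>R f (fst k + 1)
     + (X' k l \<bullet> f (fst k + 1)) *\<^sub>R f (fst k - 1)"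

lemma cross_table:
  "cross3 (f i) (f (i + 1)) = f (i - 1)" "cross3 (f (i + 1)) (f (i - 1)) = f i"
  "cross3 (f (i - 1)) (f i) = f (i + 1)"
  "cross3 (f (i + 1)) (f i) = - f (i - 1)" "cross3 (f (i - 1)) (f (i + 1)) = - f i"
  "cross3 (f i) (f (i - 1)) = - f (i + 1)"
proof -
  have *: "cross3 (f i) (f (i + 1)) = f (i - 1)" "cross3 (f (i + 1)) (f (i - 1)) = f i"
    "cross3 (f (i - 1)) (f i) = f (i + 1)"
    using f_cross[of i] f_cross[of "i + 1"] f_cross[of "i - 1"] by simp_all
  then show "cross3 (f i) (f (i + 1)) = f (i - 1)" "cross3 (f (i + 1)) (f (i - 1)) = f i"
    "cross3 (f (i - 1)) (f i) = f (i + 1)" by auto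
  show "cross3 (f (i + 1)) (f i) = - f (i - 1)" "cross3 (f (i - 1)) (f (i + 1)) = - f i"
    "cross3 (f i) (f (i - 1)) = - f (i + 1)"
    by (subst cross_skew, simp only: *)+
qed

text \<open>
The difference is orthogonal to \<open>f i\<close> and \<open>f (i + 1)\<close>, hence parallel to their cross product
\<open>f (i - 1)\<close>, to which it is orthogonal as well.
\<close>

lemma f_eqI:
  assumes "x \<bullet> f i = y \<bullet> f i" "x \<bullet> f (i + 1) = y \<bullet> f (i + 1)" "x \<bullet> f (i - 1) = y \<bullet> f (i - 1)"
  shows "x = y"
proof -
  define z where "z = x - y"
  have z: "z \<bullet> f i = 0" "z \<bullet> f (i + 1) = 0" "z \<bullet> f (i - 1) = 0"
    using assms by (simp_all add: z_def inner_diff_left)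
  have "cross3 z (cross3 (f i) (f (i + 1))) = 0"
    unfolding Lagrange using z by (simp add: inner_commute)
  then have "cross3 z (f (i - 1)) = 0" by (simp add: cross_table)
  moreover have "norm (f (i - 1)) = 1" by (simp add: norm_eq_1 f_inner)
  ultimately have "z = 0" using norm_cross_dot[of z "f (i - 1)"] z by simp
  then show ?thesis by (simp add: z_def)
qed

lemma frame_derivative:
  "X' k l \<bullet> f (fst k) = 0" "\<Xi>' k l \<bullet> f (fst k - 1) = 0"
  "X' k l \<bullet> f (fst k - 1) = - (\<Xi>' k l \<bullet> f (fst k))"
proof -
  have "\<forall>\<^sub>F v in nhds 0. norm (X k v) = 1 \<and> norm (\<Xi> k v) = 1 \<and> X k v \<bullet> \<Xi> k v = 0"
    by (rule eventually_mono[OF frames]) blast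
  then have ev: "\<forall>\<^sub>F v in nhds 0. X k v \<bullet> X k v = 1" "\<forall>\<^sub>F v in nhds 0. \<Xi> k v \<bullet> \<Xi> k v = 1"
    "\<forall>\<^sub>F v in nhds 0. X k v \<bullet> \<Xi> k v = 0"
    by (auto elim!: eventually_mono simp: dot_square_norm)
  note B = quad_approx_bilinear[OF bounded_bilinear_inner]
  from quad_approx_const_imp_zero[OF B[OF X_approx X_approx] ev(1), of l]
  show "X' k l \<bullet> f (fst k) = 0" by (simp add: X_0 inner_commute)
  from quad_approx_const_imp_zero[OF B[OF \<Xi>_approx \<Xi>_approx] ev(2), of l]
  show "\<Xi>' k l \<bullet> f (fst k - 1) = 0" by (simp add: \<Xi>_0 inner_commute)
  from quad_approx_const_imp_zero[OF B[OF X_approx \<Xi>_approx] ev(3), of l]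
  show "X' k l \<bullet> f (fst k - 1) = - (\<Xi>' k l \<bullet> f (fst k))"
    by (simp add: X_0 \<Xi>_0 inner_commute)
qed

lemma infinitesimal_rotation:
  "X' k l = cross3 (angular k l) (f (fst k))" "\<Xi>' k l = cross3 (angular k l) (f (fst k - 1))"
proof -
  show "X' k l = cross3 (angular k l) (f (fst k))"
    by (rule f_eqI[of _ "fst k"])
      (simp_all add: angular_def cross_add_left Cross3.left_diff_distrib cross_mult_left cross_table inner_add_left inner_diff_left
        f_inner frame_derivative)
  show "\<Xi>' k l = cross3 (angular k l) (f (fst k - 1))"
    by (rule f_eqI[of _ "fst k"])
      (simp_all add: angular_def cross_add_left Cross3.left_diff_distrib cross_mult_left cross_table inner_add_left inner_diff_left
        f_inner frame_derivative)
qed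

lemma bounded_linear_angular: "bounded_linear (angular k)"
proof -
  have "bounded_linear (\<lambda>l. X' k l \<bullet> c)" "bounded_linear (\<lambda>l. \<Xi>' k l \<bullet> c)" for c
    using X_approx[of k] \<Xi>_approx[of k]
    by (auto simp: quad_approx_def intro: bounded_linear_inner_left_comp)
  then show ?thesis
    unfolding angular_def by (intro bounded_linear_add bounded_linear_scaleR_const bounded_linear_minus)
qed

lemma angular_transversal:
  assumes "\<And>k. angular k l = \<omega>"
  shows "l = 0"
proof (rule transversal)
  fix k
  show "X' k l = cross3 \<omega> (f (fst k)) \<and> \<Xi>' k l = cross3 \<omega> (f (fst k - 1))"
    by (rule conjI[OF infinitesimal_rotation[of k l, unfolded assms]])
qed

lemma \<zeta>_approx: "quad_approx (\<zeta> k) (\<lambda>l. cross3 (angular k l) (f (fst k + 1)))"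
proof -
  have "cross3 (\<Xi>' k l) (X k 0) + cross3 (\<Xi> k 0) (X' k l) = cross3 (angular k l) (f (fst k + 1))" for l
    using cross3_derivation[of "angular k l" "f (fst k - 1)" "f (fst k)"]
    by (simp only: infinitesimal_rotation[of k l] X_0 \<Xi>_0 cross_table)
  moreover have "quad_approx (\<lambda>v. cross3 (\<Xi> k v) (X k v))
      (\<lambda>l. cross3 (\<Xi>' k l) (X k 0) + cross3 (\<Xi> k 0) (X' k l))"
    by (rule quad_approx_bilinear[OF bounded_bilinear_cross3 \<Xi>_approx X_approx])
  ultimately show ?thesis unfolding \<zeta>_def by (simp only:)
qed

lemma \<zeta>_0: "\<zeta> k 0 = f (fst k + 1)"
  by (simp add: \<zeta>_def X_0 \<Xi>_0 cross_table)

text \<open>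
The common kernel of the twelve first order changes of the distances, see \<open>tilt_approx\<close>.
\<close>

definition L :: "'a set" where
  "L = {l. \<forall>i \<epsilon> \<epsilon>'. angular (i, \<epsilon>) l \<bullet> f (i - 1) = angular (i + 1, \<epsilon>') l \<bullet> f (i - 1)}"

text \<open>
For \<open>l \<in> L\<close>, the common rotation to be split off; the line from which each coordinate is read is
chosen arbitrarily among the four whose angular velocities agree in that coordinate.
\<close>

definition common :: "'a \<Rightarrow> real^3" where
  "common l = (\<Sum>j\<in>UNIV. (angular (j + 1, True) l \<bullet> f j) *\<^sub>R f j)"

text \<open>
For \<open>l \<in> L\<close>, the speed at which the line turns about its own point of tangency, apart from the
common rotation.
\<close>

definition spin :: "index \<Rightarrow> 'a \<Rightarrow> real" where
  "spin k l = (angular k l - angular (fst k + 1, True) l) \<bullet> f (fst k)"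

lemma common_inner: "common l \<bullet> f j = angular (j + 1, True) l \<bullet> f j"
  by (simp add: common_def inner_sum_left f_inner if_distrib[where f = "\<lambda>x. _ * x"] sum.delta cong: if_cong)

lemma angular_on_L:
  assumes "l \<in> L"
  shows "angular k l = common l + spin k l *\<^sub>R f (fst k)"
proof (cases k)
  case (Pair i \<epsilon>)
  have L: "angular (j, \<epsilon>) l \<bullet> f (j - 1) = angular (j + 1, \<epsilon>') l \<bullet> f (j - 1)" for j \<epsilon> \<epsilon>'
    using assms unfolding L_def by blast
  show ?thesis unfolding Pair
  proof (rule f_eqI[of _ i])
    show "angular (i, \<epsilon>) l \<bullet> f i = (common l + spin (i, \<epsilon>) l *\<^sub>R f (fst (i, \<epsilon>))) \<bullet> f i"
      by (simp add: inner_add_left common_inner f_inner spin_def inner_diff_left)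
    show "angular (i, \<epsilon>) l \<bullet> f (i + 1) = (common l + spin (i, \<epsilon>) l *\<^sub>R f (fst (i, \<epsilon>))) \<bullet> f (i + 1)"
      using L[of "i - 1" True \<epsilon>] by (simp add: inner_add_left common_inner f_inner)
    show "angular (i, \<epsilon>) l \<bullet> f (i - 1) = (common l + spin (i, \<epsilon>) l *\<^sub>R f (fst (i, \<epsilon>))) \<bullet> f (i - 1)"
      using L[of i \<epsilon> True] L[of i True True] by (simp add: inner_add_left common_inner f_inner)
  qed
qed

lemma subspace_L: "subspace L"
proof -
  have "linear (angular k)" for k using bounded_linear_angular bounded_linear.linear by blast
  then show ?thesis
    by (simp add: L_def subspace_def linear_0 linear_add linear_scale inner_add_left) metis
qed

text \<open>
The map \<open>\<Phi>\<close> which adds a common rotation \<open>\<omega>\<close> to the angular velocities of \<open>l\<close> is injective by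
transversality, hence an isomorphism, as both sides have dimension \<open>15 + 3 = 6 \<sdot> 3\<close>.
Prescribing the six spins and solving for \<open>l\<close> and \<open>\<omega>\<close> parametrizes \<open>L\<close>.
\<close>

lemma dim_L: "dim L = 6"
proof -
  have lin: "linear (angular k)" for k using bounded_linear_angular bounded_linear.linear by blast
  define \<Phi> :: "'a \<times> (real^3) \<Rightarrow> (real^3)^index" where "\<Phi> p = (\<chi> k. angular k (fst p) + snd p)" for p
  have lin\<Phi>: "linear \<Phi>"
    by (rule linearI)
      (simp_all add: \<Phi>_def vec_eq_iff linear_add[OF lin] linear_scale[OF lin] scaleR_add_right)
  have inj\<Phi>: "inj \<Phi>"
  proof (rule linear_injective_0[OF lin\<Phi>, THEN iffD2], intro allI impI)
    fix p assume "\<Phi> p = 0"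
    then have "\<Phi> p $ k = 0" for k by simp
    then have angular: "angular k (fst p) = - snd p" for k
      by (simp add: \<Phi>_def eq_neg_iff_add_eq_0)
    then have "fst p = 0" by (rule angular_transversal)
    with angular[of "(1, True)"] show "p = 0" by (simp add: linear_0[OF lin] prod_eq_iff)
  qed
  have "dim (range \<Phi>) = DIM((real^3)^index)"
    using dim_image_eq[OF lin\<Phi>, of UNIV] inj\<Phi> by (simp add: dimension)
  then have surj: "surj \<Phi>"
    using lin\<Phi> by (metis dim_eq_full linear_subspace_image span_eq_iff subspace_UNIV)
  obtain \<Psi> where lin\<Psi>: "linear \<Psi>" and \<Psi>: "\<And>p. \<Psi> (\<Phi> p) = p"
    using linear_injective_left_inverse[OF lin\<Phi> inj\<Phi>] by (auto simp: fun_eq_iff)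
  have \<Phi>\<Psi>: "\<Phi> (\<Psi> w) = w" for w using surj \<Psi> by (metis surjD)
  define S :: "real^index \<Rightarrow> (real^3)^index" where "S a = (\<chi> k. a $ k *\<^sub>R f (fst k))" for a
  define J where "J a = fst (\<Psi> (S a))" for a
  have linS: "linear S"
    by (rule linearI) (simp_all add: S_def vec_eq_iff scaleR_add_left)
  have linJ: "linear J"
    unfolding J_def using linear_compose[OF linear_compose[OF linS lin\<Psi>] linear_fst]
    by (simp add: o_def)
  have J: "angular k (J a) = a $ k *\<^sub>R f (fst k) - snd (\<Psi> (S a))" for a k
    using arg_cong[OF \<Phi>\<Psi>[of "S a"], of "\<lambda>w. w $ k"] by (simp add: J_def \<Phi>_def S_def eq_diff_eq)
  have "inj J"
  proof (rule linear_injective_0[OF linJ, THEN iffD2], intro allI impI)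
    fix a assume "J a = 0"
    then have *: "a $ k *\<^sub>R f (fst k) = snd (\<Psi> (S a))" for k
      using J[of k a] by (simp add: linear_0[OF lin])
    have "a $ k = 0" for k
      using arg_cong[OF trans[OF *[of k] *[of "(fst k + 1, True)", symmetric]], of "\<lambda>x. x \<bullet> f (fst k)"]
      by (simp add: f_inner)
    then show "a = 0" by (simp add: vec_eq_iff)
  qed
  moreover have "range J = L"
  proof
    show "range J \<subseteq> L" by (auto simp: L_def J inner_diff_left f_inner)
    show "L \<subseteq> range J"
    proof
      fix l assume l: "l \<in> L"
      have "\<Phi> (l, - common l) = S (\<chi> k. spin k l)"
        by (simp add: \<Phi>_def S_def vec_eq_iff angular_on_L[OF l])
      then have "J (\<chi> k. spin k l) = l"
        unfolding J_def by (metis \<Psi> fst_conv)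
      then show "l \<in> range J" by (rule range_eqI[OF sym])
    qed
  qed
  ultimately show ?thesis
    using dim_image_eq[OF linJ, of UNIV] by (simp add: card_prod)
qed

text \<open>
Octahedrally \<open>\<Xi> (i, \<epsilon>)\<close> and \<open>\<zeta> (i + 1, \<epsilon>')\<close> coincide, while \<open>\<Xi> (i + 1, \<epsilon>')\<close> is orthogonal to both
\<open>\<zeta> (i, \<epsilon>)\<close> and \<open>\<Xi> (i, \<epsilon>)\<close>.  The functions \<open>deviation\<close>, \<open>tilt\<close> and \<open>cosine\<close> measure how far these
three relations fail.
\<close>

definition deviation :: "3 \<Rightarrow> bool \<Rightarrow> bool \<Rightarrow> 'a \<Rightarrow> real^3" where
  "deviation i \<epsilon> \<epsilon>' v = \<Xi> (i, \<epsilon>) v - \<zeta> (i + 1, \<epsilon>') v"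

definition tilt :: "3 \<Rightarrow> bool \<Rightarrow> bool \<Rightarrow> 'a \<Rightarrow> real" where
  "tilt i \<epsilon> \<epsilon>' v = \<Xi> (i + 1, \<epsilon>') v \<bullet> \<zeta> (i, \<epsilon>) v"

definition cosine :: "3 \<Rightarrow> bool \<Rightarrow> bool \<Rightarrow> 'a \<Rightarrow> real" where
  "cosine i \<epsilon> \<epsilon>' v = \<Xi> (i, \<epsilon>) v \<bullet> \<Xi> (i + 1, \<epsilon>') v"

definition line_dist :: "3 \<Rightarrow> bool \<Rightarrow> bool \<Rightarrow> 'a \<Rightarrow> real" where
  "line_dist i \<epsilon> \<epsilon>' v = setdist (lines v (i, \<epsilon>)) (lines v (i + 1, \<epsilon>'))"

definition numer :: "3 \<Rightarrow> bool \<Rightarrow> bool \<Rightarrow> 'a \<Rightarrow> real" where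
  "numer i \<epsilon> \<epsilon>' v = \<Xi> (i, \<epsilon>) v \<bullet> \<zeta> (i + 1, \<epsilon>') v + sgn_of \<epsilon> * sgn_of \<epsilon>' * tilt i \<epsilon> \<epsilon>' v"

text \<open>
The coefficient in \<open>n / \<rho> - n = weight \<sdot> cosine\<^sup>2\<close>, where \<open>n\<close> is the numerator and
\<open>\<rho> = sqrt (1 - cosine\<^sup>2)\<close> the denominator of the distance.
\<close>

definition weight :: "3 \<Rightarrow> bool \<Rightarrow> bool \<Rightarrow> 'a \<Rightarrow> real" where
  "weight i \<epsilon> \<epsilon>' v = numer i \<epsilon> \<epsilon>' v
     / (sqrt (1 - (cosine i \<epsilon> \<epsilon>' v)\<^sup>2) * (1 + sqrt (1 - (cosine i \<epsilon> \<epsilon>' v)\<^sup>2)))"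

lemma deviation_0: "deviation i \<epsilon> \<epsilon>' 0 = 0"
  by (simp add: deviation_def \<Xi>_0 \<zeta>_0)

lemma tilt_0: "tilt i \<epsilon> \<epsilon>' 0 = 0"
  by (simp add: tilt_def \<Xi>_0 \<zeta>_0 f_inner)

lemma cosine_0: "cosine i \<epsilon> \<epsilon>' 0 = 0"
  by (simp add: cosine_def \<Xi>_0 f_inner)

lemma cross_inner_swap: "cross3 w a \<bullet> b = w \<bullet> cross3 a b"
  by (metis cross_triple inner_commute)

lemma \<Xi>_approx_angular: "quad_approx (\<Xi> k) (\<lambda>l. cross3 (angular k l) (f (fst k - 1)))"
  using \<Xi>_approx[of k] infinitesimal_rotation(2)[of k, abs_def] by (metis (no_types, lifting) ext)

lemma deviation_approx:
  "quad_approx (deviation i \<epsilon> \<epsilon>') (\<lambda>l. cross3 (angular (i, \<epsilon>) l - angular (i + 1, \<epsilon>') l) (f (i - 1)))"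
  using quad_approx_diff[OF \<Xi>_approx_angular[of "(i, \<epsilon>)"] \<zeta>_approx[of "(i + 1, \<epsilon>')"]]
  unfolding deviation_def[abs_def] by (simp add: Cross3.left_diff_distrib)

lemma tilt_approx:
  "quad_approx (tilt i \<epsilon> \<epsilon>') (\<lambda>l. (angular (i + 1, \<epsilon>') l - angular (i, \<epsilon>) l) \<bullet> f (i - 1))"
proof -
  have "cross3 (angular (i + 1, \<epsilon>') l) (f i) \<bullet> f (i + 1) + f i \<bullet> cross3 (angular (i, \<epsilon>) l) (f (i + 1))
      = (angular (i + 1, \<epsilon>') l - angular (i, \<epsilon>) l) \<bullet> f (i - 1)" for l
    by (simp add: inner_commute[of "f i"] cross_inner_swap cross_table inner_diff_left)
  then show ?thesis
    using quad_approx_bilinear[OF bounded_bilinear_inner \<Xi>_approx_angular[of "(i + 1, \<epsilon>')"] \<zeta>_approx[of "(i, \<epsilon>)"]]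
    unfolding tilt_def[abs_def] by (simp add: \<Xi>_0 \<zeta>_0)
qed

lemma cosine_approx:
  "quad_approx (cosine i \<epsilon> \<epsilon>') (\<lambda>l. (angular (i, \<epsilon>) l - angular (i + 1, \<epsilon>') l) \<bullet> f (i + 1))"
proof -
  have "cross3 (angular (i, \<epsilon>) l) (f (i - 1)) \<bullet> f i + f (i - 1) \<bullet> cross3 (angular (i + 1, \<epsilon>') l) (f i)
      = (angular (i, \<epsilon>) l - angular (i + 1, \<epsilon>') l) \<bullet> f (i + 1)" for l
    by (simp add: inner_commute[of "f (i - 1)"] cross_inner_swap cross_table inner_diff_left)
  then show ?thesis
    using quad_approx_bilinear[OF bounded_bilinear_inner \<Xi>_approx_angular[of "(i, \<epsilon>)"] \<Xi>_approx_angular[of "(i + 1, \<epsilon>')"]]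
    unfolding cosine_def[abs_def] by (simp add: \<Xi>_0)
qed

lemma numer_tendsto: "(numer i \<epsilon> \<epsilon>' \<longlongrightarrow> 1) (nhds 0)"
proof -
  have "(numer i \<epsilon> \<epsilon>' \<longlongrightarrow> f (i - 1) \<bullet> f (i - 1) + sgn_of \<epsilon> * sgn_of \<epsilon>' * 0) (nhds 0)"
    unfolding numer_def[abs_def]
    using quad_approx_tendsto[OF \<Xi>_approx[of "(i, \<epsilon>)"]] quad_approx_tendsto[OF \<zeta>_approx[of "(i + 1, \<epsilon>')"]]
      quad_approx_tendsto[OF tilt_approx[of i \<epsilon> \<epsilon>']]
    by (intro tendsto_intros) (simp_all add: \<Xi>_0 \<zeta>_0 tilt_0)
  then show ?thesis by (simp add: f_inner)
qed

lemma cosine_tendsto: "(cosine i \<epsilon> \<epsilon>' \<longlongrightarrow> 0) (nhds 0)"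
  using quad_approx_tendsto[OF cosine_approx[of i \<epsilon> \<epsilon>']] by (simp add: cosine_0)

lemma weight_tendsto: "(weight i \<epsilon> \<epsilon>' \<longlongrightarrow> 1 / 2) (nhds 0)"
proof -
  have "(weight i \<epsilon> \<epsilon>' \<longlongrightarrow> 1 / (sqrt (1 - 0\<^sup>2) * (1 + sqrt (1 - 0\<^sup>2)))) (nhds 0)"
    unfolding weight_def[abs_def]
    by (intro tendsto_intros numer_tendsto cosine_tendsto) simp
  then show ?thesis by simp
qed

text \<open>
An exact formula in which only the term with \<open>tilt\<close> is of first order; the term with \<open>cosine\<close> is
nonnegative and can be dropped in lower bounds.
\<close>

lemma distance_formula:
  "\<forall>\<^sub>F v in nhds 0. 0 \<le> weight i \<epsilon> \<epsilon>' v \<and>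
     line_dist i \<epsilon> \<epsilon>' v - 1 = - (norm (deviation i \<epsilon> \<epsilon>' v))\<^sup>2 / 2 + sgn_of \<epsilon> * sgn_of \<epsilon>' * tilt i \<epsilon> \<epsilon>' v
       + weight i \<epsilon> \<epsilon>' v * (cosine i \<epsilon> \<epsilon>' v)\<^sup>2"
proof -
  have "((\<lambda>v. (cosine i \<epsilon> \<epsilon>' v)\<^sup>2) \<longlongrightarrow> 0\<^sup>2) (nhds 0)"
    by (intro tendsto_intros cosine_tendsto)
  then have "\<forall>\<^sub>F v in nhds 0. (cosine i \<epsilon> \<epsilon>' v)\<^sup>2 < 1"
    by (rule order_tendstoD(2)) simp
  moreover have "\<forall>\<^sub>F v in nhds 0. 0 < numer i \<epsilon> \<epsilon>' v"
    using numer_tendsto by (rule order_tendstoD(1)) simp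
  ultimately show ?thesis using frames
  proof eventually_elim
    case (elim v)
    define s N r where "s = cosine i \<epsilon> \<epsilon>' v" and "N = numer i \<epsilon> \<epsilon>' v" and "r = sqrt (1 - s\<^sup>2)"
    have u: "norm (X k v) = 1" "norm (\<Xi> k v) = 1" "X k v \<bullet> \<Xi> k v = 0" for k
      using elim(3) by blast+
    have "(norm (\<zeta> k v))\<^sup>2 = 1" for k
      unfolding \<zeta>_def norm_cross using u by (simp add: inner_commute)
    then have "(norm (deviation i \<epsilon> \<epsilon>' v))\<^sup>2 = 2 - 2 * (\<Xi> (i, \<epsilon>) v \<bullet> \<zeta> (i + 1, \<epsilon>') v)"
      unfolding deviation_def power2_norm_eq_inner inner_diff_left inner_diff_right
      using u(2)[of "(i, \<epsilon>)"] by (simp add: dot_square_norm inner_commute)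
    then have N: "N - 1 = - (norm (deviation i \<epsilon> \<epsilon>' v))\<^sup>2 / 2 + sgn_of \<epsilon> * sgn_of \<epsilon>' * tilt i \<epsilon> \<epsilon>' v"
      by (simp add: N_def numer_def)
    have r: "r > 0" "r * r = 1 - s\<^sup>2" using elim(1) by (simp_all add: r_def s_def flip: power2_eq_square)
    have "line_dist i \<epsilon> \<epsilon>' v = \<bar>N\<bar> / r"
      unfolding line_dist_def lines_def fst_conv snd_conv N_def r_def s_def numer_def cosine_def tilt_def \<zeta>_def
      using elim(1) u by (intro setdist_opposite_tangent_lines) (auto simp: cosine_def)
    then have d: "line_dist i \<epsilon> \<epsilon>' v = N / r" using elim(2) by (simp add: N_def)
    have "1 - r * r = (1 - r) * (1 + r)" by (simp add: algebra_simps)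
    then have "N / (r * (1 + r)) * (1 - r * r) = N * (1 - r) / r" using r(1) by simp
    also have "\<dots> = N / r - N" using r(1) by (simp add: field_simps)
    finally have "N / r - 1 = (N - 1) + N / (r * (1 + r)) * (1 - r * r)" by simp
    then have "line_dist i \<epsilon> \<epsilon>' v - 1 = (N - 1) + weight i \<epsilon> \<epsilon>' v * s\<^sup>2"
      unfolding d weight_def N_def[symmetric] s_def[symmetric] r_def[symmetric] using r(2) by simp
    moreover have "0 \<le> weight i \<epsilon> \<epsilon>' v"
      unfolding weight_def N_def[symmetric] s_def[symmetric] r_def[symmetric]
      using r(1) elim(2) by (simp add: N_def)
    ultimately show ?case unfolding N s_def by simp
  qed
qed

lemma ray_0:
  fixes l :: 'a
  assumes "(h \<longlongrightarrow> c) (nhds 0)"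
  shows "((\<lambda>t. h (t *\<^sub>R l)) \<longlongrightarrow> c) (at_right (0::real))"
  using filterlim_compose[OF assms filterlim_scaleR_nhds_0] .

lemma distance_first_order:
  "((\<lambda>t. (line_dist i \<epsilon> \<epsilon>' (t *\<^sub>R l) - 1) / t) \<longlongrightarrow>
     sgn_of \<epsilon> * sgn_of \<epsilon>' * ((angular (i + 1, \<epsilon>') l - angular (i, \<epsilon>) l) \<bullet> f (i - 1))) (at_right 0)"
proof -
  define G where "G t = - (norm (deviation i \<epsilon> \<epsilon>' (t *\<^sub>R l) /\<^sub>R t))\<^sup>2 / 2 * t
      + sgn_of \<epsilon> * sgn_of \<epsilon>' * (tilt i \<epsilon> \<epsilon>' (t *\<^sub>R l) /\<^sub>R t)
      + weight i \<epsilon> \<epsilon>' (t *\<^sub>R l) * (cosine i \<epsilon> \<epsilon>' (t *\<^sub>R l) /\<^sub>R t)\<^sup>2 * t" for t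
  have "(G \<longlongrightarrow> - (norm (cross3 (angular (i, \<epsilon>) l - angular (i + 1, \<epsilon>') l) (f (i - 1))))\<^sup>2 / 2 * 0
      + sgn_of \<epsilon> * sgn_of \<epsilon>' * ((angular (i + 1, \<epsilon>') l - angular (i, \<epsilon>) l) \<bullet> f (i - 1))
      + 1 / 2 * ((angular (i, \<epsilon>) l - angular (i + 1, \<epsilon>') l) \<bullet> f (i + 1))\<^sup>2 * 0) (at_right 0)"
    unfolding G_def[abs_def]
    using quad_approx_along_ray[OF deviation_approx[of i \<epsilon> \<epsilon>'], of l]
      quad_approx_along_ray[OF tilt_approx[of i \<epsilon> \<epsilon>'], of l]
      quad_approx_along_ray[OF cosine_approx[of i \<epsilon> \<epsilon>'], of l] ray_0[OF weight_tendsto[of i \<epsilon> \<epsilon>'], of l]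
    by (intro tendsto_intros) (simp_all add: deviation_0 tilt_0 cosine_0)
  moreover have "\<forall>\<^sub>F t in at_right 0. G t = (line_dist i \<epsilon> \<epsilon>' (t *\<^sub>R l) - 1) / t"
    using eventually_compose_filterlim[OF distance_formula[of i \<epsilon> \<epsilon>'] filterlim_scaleR_nhds_0[of l]]
      eventually_at_right_less[of "0::real"]
  proof eventually_elim
    case (elim t)
    have "G t = (- (norm (deviation i \<epsilon> \<epsilon>' (t *\<^sub>R l)))\<^sup>2 / 2
        + sgn_of \<epsilon> * sgn_of \<epsilon>' * tilt i \<epsilon> \<epsilon>' (t *\<^sub>R l)
        + weight i \<epsilon> \<epsilon>' (t *\<^sub>R l) * (cosine i \<epsilon> \<epsilon>' (t *\<^sub>R l))\<^sup>2) / t"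
      using elim(2) by (simp add: G_def field_simps power2_eq_square)
    then show ?case using elim(1) by simp
  qed
  ultimately show ?thesis by (simp add: filterlim_cong[OF refl refl])
qed

text \<open>
Minus the second order coefficient of the sum of the four distances between the lines
\<open>(i, \<epsilon>)\<close> and \<open>(i + 1, \<epsilon>')\<close>.
\<close>

definition decay :: "3 \<Rightarrow> 'a \<Rightarrow> real" where
  "decay i l = (spin (i, True) l)\<^sup>2 + (spin (i, False) l)\<^sup>2
     + (spin (i, True) l - spin (i, False) l) * (spin (i + 1, True) l - spin (i + 1, False) l)"

text \<open>
In the sum over all signs the first order terms \<open>\<epsilon> \<epsilon>' \<Xi> (i + 1, \<epsilon>') \<bullet> \<zeta> (i, \<epsilon>)\<close> combine to \<open>P \<bullet> Z\<close>
with two factors that vanish at \<open>0\<close>, so that the limit is determined by the first derivatives of the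
frames.
\<close>

lemma distance_second_order:
  assumes l: "l \<in> L"
  shows "((\<lambda>t. (line_dist i True True (t *\<^sub>R l) + line_dist i True False (t *\<^sub>R l) + line_dist i False True (t *\<^sub>R l)
      + line_dist i False False (t *\<^sub>R l) - 4) / t\<^sup>2) \<longlongrightarrow> - decay i l) (at_right 0)"
proof -
  define H where "H \<epsilon> \<epsilon>' t = - (norm (deviation i \<epsilon> \<epsilon>' (t *\<^sub>R l) /\<^sub>R t))\<^sup>2 / 2
      + weight i \<epsilon> \<epsilon>' (t *\<^sub>R l) * (cosine i \<epsilon> \<epsilon>' (t *\<^sub>R l) /\<^sub>R t)\<^sup>2" for \<epsilon> \<epsilon>' t
  define P where "P v = \<Xi> (i + 1, True) v - \<Xi> (i + 1, False) v" for v
  define Z where "Z v = \<zeta> (i, True) v - \<zeta> (i, False) v" for v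
  define K where "K t = (P (t *\<^sub>R l) /\<^sub>R t) \<bullet> (Z (t *\<^sub>R l) /\<^sub>R t)" for t
  have Wdiff: "angular (i, \<epsilon>) l - angular (i + 1, \<epsilon>') l = spin (i, \<epsilon>) l *\<^sub>R f i - spin (i + 1, \<epsilon>') l *\<^sub>R f (i + 1)" for \<epsilon> \<epsilon>'
    by (simp add: angular_on_L[OF l])
  have Wd: "angular (j, True) l - angular (j, False) l = (spin (j, True) l - spin (j, False) l) *\<^sub>R f j" for j
    by (simp add: angular_on_L[OF l] scaleR_diff_left)
  have H: "(H \<epsilon> \<epsilon>' \<longlongrightarrow> - (spin (i, \<epsilon>) l)\<^sup>2 / 2) (at_right 0)" for \<epsilon> \<epsilon>'
  proof -
    have "(H \<epsilon> \<epsilon>' \<longlongrightarrow> - (norm (cross3 (angular (i, \<epsilon>) l - angular (i + 1, \<epsilon>') l) (f (i - 1))))\<^sup>2 / 2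
        + 1 / 2 * ((angular (i, \<epsilon>) l - angular (i + 1, \<epsilon>') l) \<bullet> f (i + 1))\<^sup>2) (at_right 0)"
      unfolding H_def[abs_def]
      using quad_approx_along_ray[OF deviation_approx[of i \<epsilon> \<epsilon>'], of l]
        quad_approx_along_ray[OF cosine_approx[of i \<epsilon> \<epsilon>'], of l] ray_0[OF weight_tendsto[of i \<epsilon> \<epsilon>'], of l]
      by (intro tendsto_intros) (simp_all add: deviation_0 cosine_0)
    moreover have "(norm (cross3 (angular (i, \<epsilon>) l - angular (i + 1, \<epsilon>') l) (f (i - 1))))\<^sup>2
        = (spin (i, \<epsilon>) l)\<^sup>2 + (spin (i + 1, \<epsilon>') l)\<^sup>2"
      unfolding Wdiff power2_norm_eq_inner
      by (simp add: Cross3.left_diff_distrib cross_mult_left cross_table inner_diff_left inner_diff_right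
          f_inner power2_eq_square)
    moreover have "(angular (i, \<epsilon>) l - angular (i + 1, \<epsilon>') l) \<bullet> f (i + 1) = - spin (i + 1, \<epsilon>') l"
      unfolding Wdiff by (simp add: inner_diff_left f_inner)
    ultimately show ?thesis by (simp add: field_simps)
  qed
  have "quad_approx P (\<lambda>l. cross3 (angular (i + 1, True) l) (f i) - cross3 (angular (i + 1, False) l) (f i))"
    unfolding P_def[abs_def] using quad_approx_diff[OF \<Xi>_approx_angular[of "(i + 1, True)"] \<Xi>_approx_angular[of "(i + 1, False)"]]
    by simp
  moreover have "quad_approx Z (\<lambda>l. cross3 (angular (i, True) l) (f (i + 1)) - cross3 (angular (i, False) l) (f (i + 1)))"
    unfolding Z_def[abs_def] using quad_approx_diff[OF \<zeta>_approx[of "(i, True)"] \<zeta>_approx[of "(i, False)"]]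
    by simp
  moreover have "P 0 = 0" "Z 0 = 0" by (simp_all add: P_def Z_def \<Xi>_0 \<zeta>_0)
  ultimately have "(K \<longlongrightarrow> (cross3 (angular (i + 1, True) l) (f i) - cross3 (angular (i + 1, False) l) (f i))
      \<bullet> (cross3 (angular (i, True) l) (f (i + 1)) - cross3 (angular (i, False) l) (f (i + 1)))) (at_right 0)"
    unfolding K_def[abs_def]
    by (intro tendsto_inner) (use quad_approx_along_ray in fastforce)+
  then have K: "(K \<longlongrightarrow> - ((spin (i, True) l - spin (i, False) l) * (spin (i + 1, True) l - spin (i + 1, False) l)))
      (at_right 0)"
    unfolding Cross3.left_diff_distrib[symmetric] Wd
    by (simp only: cross_mult_left cross_table inner_scaleR_left inner_scaleR_right inner_minus_left f_inner)
      (simp add: algebra_simps)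
  have "((\<lambda>t. H True True t + H True False t + H False True t + H False False t + K t) \<longlongrightarrow>
      - (spin (i, True) l)\<^sup>2 / 2 + - (spin (i, True) l)\<^sup>2 / 2 + - (spin (i, False) l)\<^sup>2 / 2 + - (spin (i, False) l)\<^sup>2 / 2
      + - ((spin (i, True) l - spin (i, False) l) * (spin (i + 1, True) l - spin (i + 1, False) l))) (at_right 0)"
    by (intro tendsto_add H K)
  then have lim: "((\<lambda>t. H True True t + H True False t + H False True t + H False False t + K t) \<longlongrightarrow> - decay i l) (at_right 0)"
    by (simp add: decay_def algebra_simps)
  note ev = eventually_compose_filterlim[OF distance_formula filterlim_scaleR_nhds_0[of l]]
  have "\<forall>\<^sub>F t in at_right 0. H True True t + H True False t + H False True t + H False False t + K t
    = (line_dist i True True (t *\<^sub>R l) + line_dist i True False (t *\<^sub>R l) + line_dist i False True (t *\<^sub>R l)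
      + line_dist i False False (t *\<^sub>R l) - 4) / t\<^sup>2"
    using ev[of i True True] ev[of i True False] ev[of i False True] ev[of i False False]
      eventually_at_right_less[of "0::real"]
  proof eventually_elim
    case (elim t)
    let ?v = "t *\<^sub>R l"
    \<comment> \<open>The first order terms are collected in \<open>K\<close>; \<open>H\<close> contains the remaining part of each distance.\<close>
    have d: "t\<^sup>2 * H \<epsilon> \<epsilon>' t = - (norm (deviation i \<epsilon> \<epsilon>' ?v))\<^sup>2 / 2 + weight i \<epsilon> \<epsilon>' ?v * (cosine i \<epsilon> \<epsilon>' ?v)\<^sup>2" for \<epsilon> \<epsilon>'
      using elim(5) by (simp add: H_def field_simps power2_eq_square)
    have "t\<^sup>2 * K t = P ?v \<bullet> Z ?v"
      using elim(5) by (simp add: K_def field_simps power2_eq_square)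
    also have "\<dots> = tilt i True True ?v - tilt i True False ?v - tilt i False True ?v + tilt i False False ?v"
      by (simp add: P_def Z_def tilt_def inner_diff_left inner_diff_right)
    finally have "t\<^sup>2 * (H True True t + H True False t + H False True t + H False False t + K t)
      = (line_dist i True True ?v - 1) + (line_dist i True False ?v - 1) + (line_dist i False True ?v - 1) + (line_dist i False False ?v - 1)"
      using elim d by (simp add: distrib_left)
    then show ?case using elim(5) by (simp add: field_simps)
  qed
  from Lim_transform_eventually[OF lim this] show ?thesis .
qed

lemma spin_scale: "spin k (c *\<^sub>R l) = c * spin k l"
proof -
  have "angular k (c *\<^sub>R l) = c *\<^sub>R angular k l" for k
    using bounded_linear_angular by (rule linear_simps(5))
  then show ?thesis by (simp add: spin_def inner_diff_left algebra_simps)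
qed

lemma decay_scale: "decay i (c *\<^sub>R l) = c\<^sup>2 * decay i l"
  by (simp add: decay_def spin_scale power2_eq_square algebra_simps)

lemma continuous_decay: "continuous_on S (decay i)"
proof -
  have "continuous_on S (angular k)" for k
    using bounded_linear_angular by (rule linear_continuous_on)
  then have "continuous_on S (spin k)" for k
    unfolding spin_def[abs_def] by (intro continuous_intros)
  then show ?thesis unfolding decay_def[abs_def] by (intro continuous_intros)
qed

lemma decay_pos:
  assumes l: "l \<in> L" "l \<noteq> 0"
  shows "\<exists>i. decay i l > 0"
proof (rule ccontr)
  assume "\<nexists>i. decay i l > 0"
  then have "decay i l \<le> 0" for i by (simp add: not_less)
  then have "spin (i, True) l = 0 \<and> spin (i, False) l = 0" for i
    using cyclic_definite[of "\<lambda>i. spin (i, True) l" "\<lambda>i. spin (i, False) l" i] unfolding decay_def by blast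
  then have "spin k l = 0" for k by (cases k; cases "snd k") auto
  then have "angular k l = common l" for k using angular_on_L[OF l(1), of k] by simp
  then show False using angular_transversal l(2) by blast
qed

text \<open>
The maximum of the three forms is continuous and positive on the compact unit sphere of \<open>L\<close>.
\<close>

lemma decay_uniformly_pos: "\<exists>m>0. \<forall>l\<in>L. \<exists>i. decay i l \<ge> m * (norm l)\<^sup>2"
proof -
  define M where "M l = max (decay 1 l) (max (decay 2 l) (decay 3 l))" for l
  have M: "M l = c \<Longrightarrow> \<exists>i. decay i l \<ge> c" for l c
    unfolding M_def max_def by (metis order_refl)
  have Mdecay: "decay i l \<le> M l" for i l
    using exhaust_3[of i] unfolding M_def by auto
  define S where "S = L \<inter> sphere 0 1"
  have "compact S" unfolding S_def
    by (intro closed_Int_compact closed_subspace subspace_L compact_sphere)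
  moreover have "continuous_on S M" unfolding M_def[abs_def]
    by (intro continuous_on_max continuous_decay)
  ultimately have "\<exists>m>0. \<forall>y\<in>S. m \<le> M y"
  proof (cases "S = {}")
    case False
    with \<open>compact S\<close> \<open>continuous_on S M\<close> obtain x where x: "x \<in> S" "\<forall>y\<in>S. M x \<le> M y"
      using continuous_attains_inf by blast
    have "x \<in> L" "x \<noteq> 0" using x(1) by (auto simp: S_def)
    then obtain i where "decay i x > 0" using decay_pos by blast
    then have "M x > 0" using Mdecay[of i x] by simp
    then show ?thesis using x(2) by blast
  qed (auto intro: exI[of _ 1])
  then obtain m where m: "m > 0" "\<And>y. y \<in> S \<Longrightarrow> m \<le> M y" by blast
  have "\<exists>i. decay i l \<ge> m * (norm l)\<^sup>2" if l: "l \<in> L" for l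
  proof (cases "l = 0")
    case True
    then show ?thesis using decay_scale[of _ 0 l] by simp
  next
    case False
    define y where "y = l /\<^sub>R norm l"
    have "y \<in> S" using l False subspace_L by (auto simp: S_def y_def subspace_scale)
    then have "m \<le> M y" by (rule m(2))
    moreover obtain i where "M y \<le> decay i y" using M[OF refl] by blast
    ultimately have i: "decay i y \<ge> m" by simp
    have "decay i l = (norm l)\<^sup>2 * decay i y" using decay_scale[of i "norm l" y] False by (simp add: y_def)
    then show ?thesis
      using mult_right_mono[OF i, of "(norm l)\<^sup>2"] by (intro exI[of _ i]) (simp add: mult.commute)
  qed
  then show ?thesis using m(1) by blast
qed

lemma D_tilde_lines_le: "D_tilde (lines v) \<le> line_dist i \<epsilon> \<epsilon>' v"
  unfolding line_dist_def by (rule D_tilde_le)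

lemma D_tilde_lines_ge:
  assumes "\<And>k. \<forall>\<^sub>F t in F. c t \<le> (case k of (i, \<epsilon>, \<epsilon>') \<Rightarrow> line_dist i \<epsilon> \<epsilon>' (v t) - 1)"
  shows "\<forall>\<^sub>F t in F. c t \<le> D_tilde (lines (v t)) - 1"
proof -
  have "\<forall>\<^sub>F t in F. \<forall>k. c t \<le> (case k of (i, \<epsilon>, \<epsilon>') \<Rightarrow> line_dist i \<epsilon> \<epsilon>' (v t) - 1)"
    using assms by (rule eventually_all_finite)
  then show ?thesis
  proof eventually_elim
    case (elim t)
    have "c t + 1 \<le> D_tilde (lines (v t))"
    proof (rule D_tilde_ge)
      fix i \<epsilon> \<epsilon>'
      show "c t + 1 \<le> setdist (lines (v t) (i, \<epsilon>)) (lines (v t) (i + 1, \<epsilon>'))"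
        using spec[OF elim, of "(i, \<epsilon>, \<epsilon>')"] by (simp add: line_dist_def)
    qed
    then show ?case by simp
  qed
qed

lemma D_tilde_lines_0: "D_tilde (lines 0) = 1"
proof -
  have d: "line_dist i \<epsilon> \<epsilon>' 0 = 1" for i \<epsilon> \<epsilon>'
    using eventually_nhds_x_imp_x[OF distance_formula[of i \<epsilon> \<epsilon>']] by (simp add: deviation_0 tilt_0 cosine_0)
  have "D_tilde (lines 0) \<le> 1"
    using D_tilde_lines_le[of 0 1 True True] by (simp only: d)
  moreover have "1 \<le> D_tilde (lines 0)"
    by (rule D_tilde_ge) (simp flip: line_dist_def add: d)
  ultimately show ?thesis by simp
qed

text \<open>
For fixed \<open>i\<close> the four first order coefficients are \<open>\<epsilon> \<epsilon>' (y\<^bsub>\<epsilon>'\<^esub> - x\<^sub>\<epsilon>)\<close>.  If all were nonnegative, then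
\<open>x\<^sub>+ \<le> y\<^sub>+ \<le> x\<^sub>- \<le> y\<^sub>- \<le> x\<^sub>+\<close>, so all would vanish.
\<close>

lemma D_tilde_linear_decay:
  assumes "l \<notin> L"
  shows "\<exists>c\<^sub>d c\<^sub>u. 0 < c\<^sub>d \<and> c\<^sub>d \<le> c\<^sub>u \<and> (\<forall>\<^sub>F t in at_right 0.
    - c\<^sub>u * t \<le> D_tilde (lines (t *\<^sub>R l)) - 1 \<and> D_tilde (lines (t *\<^sub>R l)) - 1 \<le> - c\<^sub>d * t)"
proof -
  define g where "g i \<epsilon> \<epsilon>' = sgn_of \<epsilon> * sgn_of \<epsilon>' * ((angular (i + 1, \<epsilon>') l - angular (i, \<epsilon>) l) \<bullet> f (i - 1))" for i \<epsilon> \<epsilon>'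
  have lim: "((\<lambda>t. (line_dist i \<epsilon> \<epsilon>' (t *\<^sub>R l) - 1) / t) \<longlongrightarrow> g i \<epsilon> \<epsilon>') (at_right 0)" for i \<epsilon> \<epsilon>'
    unfolding g_def by (rule distance_first_order)
  have pos: "\<forall>\<^sub>F t in at_right 0. t > (0::real)" by (rule eventually_at_right_less)
  obtain i \<epsilon> \<epsilon>' where ne: "angular (i, \<epsilon>) l \<bullet> f (i - 1) \<noteq> angular (i + 1, \<epsilon>') l \<bullet> f (i - 1)"
    using assms unfolding L_def by blast
  have "\<exists>\<epsilon> \<epsilon>'. g i \<epsilon> \<epsilon>' < 0"
  proof (rule ccontr)
    assume "\<nexists>\<epsilon> \<epsilon>'. g i \<epsilon> \<epsilon>' < 0"
    then have nn: "g i \<epsilon> \<epsilon>' \<ge> 0" for \<epsilon> \<epsilon>' by (simp add: not_less)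
    from ne nn[of True True] nn[of True False] nn[of False True] nn[of False False] show False
      unfolding g_def inner_diff_left by (cases \<epsilon>; cases \<epsilon>') simp_all
  qed
  then obtain \<epsilon> \<epsilon>' where neg: "g i \<epsilon> \<epsilon>' < 0" by blast
  define c\<^sub>d where "c\<^sub>d = - g i \<epsilon> \<epsilon>' / 2"
  have "\<forall>\<^sub>F t in at_right 0. (line_dist i \<epsilon> \<epsilon>' (t *\<^sub>R l) - 1) / t < - c\<^sub>d"
    using lim by (rule order_tendstoD(2)) (use neg in \<open>simp add: c\<^sub>d_def\<close>)
  with pos have upper: "\<forall>\<^sub>F t in at_right 0. D_tilde (lines (t *\<^sub>R l)) - 1 \<le> - c\<^sub>d * t"
  proof eventually_elim
    case (elim t)
    then have "line_dist i \<epsilon> \<epsilon>' (t *\<^sub>R l) - 1 \<le> - c\<^sub>d * t" by (simp add: divide_less_eq)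
    then show ?case using D_tilde_lines_le[of "t *\<^sub>R l" i \<epsilon> \<epsilon>'] by simp
  qed
  have "\<exists>C\<ge>0. \<forall>k. \<forall>\<^sub>F t in at_right 0. t > 0 \<and> - C * t \<le> (case k of (i, \<epsilon>, \<epsilon>') \<Rightarrow> line_dist i \<epsilon> \<epsilon>' (t *\<^sub>R l) - 1)"
  proof (rule uniform_over_finite_type)
    fix k :: "3 \<times> bool \<times> bool"
    obtain i \<epsilon> \<epsilon>' where k: "k = (i, \<epsilon>, \<epsilon>')" by (cases k)
    have "\<forall>\<^sub>F t in at_right 0. - (\<bar>g i \<epsilon> \<epsilon>'\<bar> + 1) < (line_dist i \<epsilon> \<epsilon>' (t *\<^sub>R l) - 1) / t"
      using lim by (rule order_tendstoD(1)) simp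
    with pos have "\<forall>\<^sub>F t in at_right 0. t > 0 \<and> - (\<bar>g i \<epsilon> \<epsilon>'\<bar> + 1) * t \<le> line_dist i \<epsilon> \<epsilon>' (t *\<^sub>R l) - 1"
      by eventually_elim (simp add: less_divide_eq)
    then show "\<exists>C\<ge>0. \<forall>\<^sub>F t in at_right 0. t > 0 \<and> - C * t \<le> (case k of (i, \<epsilon>, \<epsilon>') \<Rightarrow> line_dist i \<epsilon> \<epsilon>' (t *\<^sub>R l) - 1)"
      unfolding k by (intro exI[of _ "\<bar>g i \<epsilon> \<epsilon>'\<bar> + 1"]) simp
  next
    fix k :: "3 \<times> bool \<times> bool" and C C' :: real
    assume "\<forall>\<^sub>F t in at_right 0. t > 0 \<and> - C * t \<le> (case k of (i, \<epsilon>, \<epsilon>') \<Rightarrow> line_dist i \<epsilon> \<epsilon>' (t *\<^sub>R l) - 1)" "C \<le> C'"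
    then show "\<forall>\<^sub>F t in at_right 0. t > 0 \<and> - C' * t \<le> (case k of (i, \<epsilon>, \<epsilon>') \<Rightarrow> line_dist i \<epsilon> \<epsilon>' (t *\<^sub>R l) - 1)"
      by (elim eventually_mono) (meson less_imp_le mult_right_mono neg_le_iff_le order_trans)
  qed
  then obtain C where C: "\<And>k. \<forall>\<^sub>F t in at_right 0. t > 0 \<and> - C * t \<le> (case k of (i, \<epsilon>, \<epsilon>') \<Rightarrow> line_dist i \<epsilon> \<epsilon>' (t *\<^sub>R l) - 1)"
    by blast
  have lower: "\<forall>\<^sub>F t in at_right 0. - C * t \<le> D_tilde (lines (t *\<^sub>R l)) - 1"
    by (rule D_tilde_lines_ge, rule eventually_mono[OF C]) blast
  have "\<forall>\<^sub>F t in at_right 0. - max C c\<^sub>d * t \<le> D_tilde (lines (t *\<^sub>R l)) - 1 \<and> D_tilde (lines (t *\<^sub>R l)) - 1 \<le> - c\<^sub>d * t"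
    using pos lower upper
  proof eventually_elim
    case (elim t)
    have "- max C c\<^sub>d * t \<le> - C * t" using elim(1) by (intro mult_right_mono) auto
    then show ?case using elim by linarith
  qed
  moreover have "c\<^sub>d > 0" using neg by (simp add: c\<^sub>d_def)
  ultimately show ?thesis by (intro exI[of _ c\<^sub>d] exI[of _ "max C c\<^sub>d"]) simp
qed

lemma D_tilde_quadratic_lower:
  "\<exists>C\<ge>0. \<forall>l\<in>L. \<forall>\<^sub>F t in at_right 0. - C * (norm l)\<^sup>2 * t\<^sup>2 \<le> D_tilde (lines (t *\<^sub>R l)) - 1"
proof -
  define P where "P k C \<longleftrightarrow> (\<forall>l\<in>L. \<forall>\<^sub>F t in at_right (0::real).
    - C * (norm l)\<^sup>2 * t\<^sup>2 \<le> (case k of (i, \<epsilon>, \<epsilon>') \<Rightarrow> line_dist i \<epsilon> \<epsilon>' (t *\<^sub>R l) - 1))"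
    for k :: "3 \<times> bool \<times> bool" and C
  have "\<exists>C\<ge>0. \<forall>k. P k C"
  proof (rule uniform_over_finite_type)
    fix k :: "3 \<times> bool \<times> bool"
    obtain i \<epsilon> \<epsilon>' where k: "k = (i, \<epsilon>, \<epsilon>')" by (cases k)
    obtain A where A: "A \<ge> 0"
      "\<And>l. \<forall>\<^sub>F t in at_right (0::real). norm (deviation i \<epsilon> \<epsilon>' (t *\<^sub>R l)) \<le> A * norm l * t"
      using quad_approx_ray_bound[OF deviation_approx deviation_0] by blast
    obtain B where B: "B \<ge> 0" "\<And>l. (angular (i + 1, \<epsilon>') l - angular (i, \<epsilon>) l) \<bullet> f (i - 1) = 0 \<Longrightarrow>
      \<forall>\<^sub>F t in at_right (0::real). norm (tilt i \<epsilon> \<epsilon>' (t *\<^sub>R l)) \<le> B * (norm l)\<^sup>2 * t\<^sup>2"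
      using quad_approx_kernel_bound[OF tilt_approx tilt_0] by blast
    have "P k (A\<^sup>2 / 2 + B)"
      unfolding P_def
    proof
      fix l assume "l \<in> L"
      then have "angular (i, \<epsilon>) l \<bullet> f (i - 1) = angular (i + 1, \<epsilon>') l \<bullet> f (i - 1)" unfolding L_def by blast
      then have "(angular (i + 1, \<epsilon>') l - angular (i, \<epsilon>) l) \<bullet> f (i - 1) = 0" by (simp add: inner_diff_left)
      note tilt = B(2)[OF this]
      show "\<forall>\<^sub>F t in at_right (0::real). - (A\<^sup>2 / 2 + B) * (norm l)\<^sup>2 * t\<^sup>2
          \<le> (case k of (i, \<epsilon>, \<epsilon>') \<Rightarrow> line_dist i \<epsilon> \<epsilon>' (t *\<^sub>R l) - 1)"
        using A(2)[of l] tilt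
          eventually_compose_filterlim[OF distance_formula[of i \<epsilon> \<epsilon>'] filterlim_scaleR_nhds_0[of l]]
      proof eventually_elim
        case (elim t)
        have "(norm (deviation i \<epsilon> \<epsilon>' (t *\<^sub>R l)))\<^sup>2 \<le> (A * norm l * t)\<^sup>2"
          using elim(1) by (intro power_mono) auto
        moreover have "- \<bar>tilt i \<epsilon> \<epsilon>' (t *\<^sub>R l)\<bar> \<le> sgn_of \<epsilon> * sgn_of \<epsilon>' * tilt i \<epsilon> \<epsilon>' (t *\<^sub>R l)"
          by auto
        moreover have "0 \<le> weight i \<epsilon> \<epsilon>' (t *\<^sub>R l) * (cosine i \<epsilon> \<epsilon>' (t *\<^sub>R l))\<^sup>2"
          using elim(3) by simp
        moreover have "- (A\<^sup>2 / 2 + B) * (norm l)\<^sup>2 * t\<^sup>2 = - (A * norm l * t)\<^sup>2 / 2 - B * (norm l)\<^sup>2 * t\<^sup>2"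
          by (simp add: power_mult_distrib algebra_simps)
        ultimately show ?case using elim(2,3) unfolding k prod.case real_norm_def by linarith
      qed
    qed
    then show "\<exists>C\<ge>0. P k C" using A(1) B(1) by (intro exI[of _ "A\<^sup>2 / 2 + B"]) simp
  next
    fix k :: "3 \<times> bool \<times> bool" and C C' :: real
    assume P: "P k C" and le: "C \<le> C'"
    show "P k C'" unfolding P_def
    proof
      fix l assume "l \<in> L"
      with P have "\<forall>\<^sub>F t in at_right (0::real).
          - C * (norm l)\<^sup>2 * t\<^sup>2 \<le> (case k of (i, \<epsilon>, \<epsilon>') \<Rightarrow> line_dist i \<epsilon> \<epsilon>' (t *\<^sub>R l) - 1)"
        unfolding P_def by blast
      then show "\<forall>\<^sub>F t in at_right (0::real).
          - C' * (norm l)\<^sup>2 * t\<^sup>2 \<le> (case k of (i, \<epsilon>, \<epsilon>') \<Rightarrow> line_dist i \<epsilon> \<epsilon>' (t *\<^sub>R l) - 1)"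
      proof eventually_elim
        case (elim t)
        have "- C' * (norm l)\<^sup>2 * t\<^sup>2 \<le> - C * (norm l)\<^sup>2 * t\<^sup>2"
          using le by (intro mult_right_mono) auto
        then show ?case using elim by (rule order_trans)
      qed
    qed
  qed
  then obtain C where "C \<ge> 0" and C: "\<And>k. P k C" by blast
  have "\<forall>\<^sub>F t in at_right 0. - C * (norm l)\<^sup>2 * t\<^sup>2 \<le> D_tilde (lines (t *\<^sub>R l)) - 1" if "l \<in> L" for l
    by (rule D_tilde_lines_ge) (use C that in \<open>unfold P_def, blast\<close>)
  then show ?thesis using \<open>C \<ge> 0\<close> by blast
qed

text \<open>
The minimum is at most the average of the four distances of a class \<open>i\<close> with positive \<open>decay\<close>.
\<close>

lemma D_tilde_quadratic_upper:
  "\<exists>m>0. \<forall>l\<in>L. l \<noteq> 0 \<longrightarrow>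
     (\<forall>\<^sub>F t in at_right 0. D_tilde (lines (t *\<^sub>R l)) - 1 \<le> - m * (norm l)\<^sup>2 * t\<^sup>2)"
proof -
  obtain m where m: "m > 0" "\<And>l. l \<in> L \<Longrightarrow> \<exists>i. decay i l \<ge> m * (norm l)\<^sup>2"
    using decay_uniformly_pos by blast
  have "\<forall>\<^sub>F t in at_right 0. D_tilde (lines (t *\<^sub>R l)) - 1 \<le> - (m / 8) * (norm l)\<^sup>2 * t\<^sup>2"
    if l: "l \<in> L" "l \<noteq> 0" for l
  proof -
    obtain i where i: "decay i l \<ge> m * (norm l)\<^sup>2" using m(2) l by blast
    have "m * (norm l)\<^sup>2 > 0" using m(1) l(2) by simp
    then have "- decay i l < - (m * (norm l)\<^sup>2 / 2)" using i by linarith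
    with distance_second_order[OF l(1), of i]
    have "\<forall>\<^sub>F t in at_right 0. (line_dist i True True (t *\<^sub>R l) + line_dist i True False (t *\<^sub>R l) + line_dist i False True (t *\<^sub>R l)
      + line_dist i False False (t *\<^sub>R l) - 4) / t\<^sup>2 < - (m * (norm l)\<^sup>2 / 2)"
      by (rule order_tendstoD(2))
    with eventually_at_right_less[of "0::real"] show ?thesis
    proof eventually_elim
      case (elim t)
      let ?v = "t *\<^sub>R l"
      have "line_dist i True True ?v + line_dist i True False ?v + line_dist i False True ?v + line_dist i False False ?v - 4
          < - (m * (norm l)\<^sup>2 / 2) * t\<^sup>2"
        using elim by (simp add: divide_less_eq)
      then show ?case
        using D_tilde_lines_le[of ?v i True True] D_tilde_lines_le[of ?v i True False]
          D_tilde_lines_le[of ?v i False True] D_tilde_lines_le[of ?v i False False] by simp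
    qed
  qed
  then show ?thesis using m(1) by (intro exI[of _ "m / 8"]) simp
qed

end

section \<open>Comparison of norms and the theorem\<close>

text \<open>
The usual equivalence of norms in finite dimension, needed because \<open>N\<close> is an arbitrary norm.
\<close>

lemma is_norm_equivalent:
  fixes N :: "'a::euclidean_space \<Rightarrow> real"
  assumes "is_norm N"
  obtains A B where "A > 0" "B > 0" "\<And>x. N x \<le> B * norm x" "\<And>x. norm x \<le> A * N x"
proof -
  have N: "\<And>v. N v \<ge> 0" "\<And>v. N v = 0 \<longleftrightarrow> v = 0" "\<And>a v. N (a *\<^sub>R v) = \<bar>a\<bar> * N v"
    "\<And>v w. N (v + w) \<le> N v + N w"
    using assms by (auto simp: is_norm_def)
  have Nsum: "N (\<Sum>i\<in>I. h i) \<le> (\<Sum>i\<in>I. N (h i))" if "finite I" for I and h :: "'a \<Rightarrow> 'a"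
    using that
  proof (induction I rule: finite_induct)
    case empty
    show ?case using N(2)[of 0] by simp
  next
    case (insert i I)
    then show ?case using N(4)[of "h i" "\<Sum>i\<in>I. h i"] by simp
  qed
  define B where "B = (\<Sum>b\<in>Basis. N b) + 1"
  have B0: "B > 0" using N(1) sum_nonneg[of Basis N] by (simp add: B_def add_nonneg_pos)
  have B: "N x \<le> B * norm x" for x
  proof -
    have "N x = N (\<Sum>b\<in>Basis. (x \<bullet> b) *\<^sub>R b)" by (simp add: euclidean_representation)
    also have "\<dots> \<le> (\<Sum>b\<in>Basis. \<bar>x \<bullet> b\<bar> * N b)" 
      using Nsum[OF finite_Basis, of "\<lambda>b. (x \<bullet> b) *\<^sub>R b"] by (simp only: N(3))
    also have "\<dots> \<le> (\<Sum>b\<in>Basis. norm x * N b)"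
      by (intro sum_mono mult_right_mono N Basis_le_norm)
    also have "\<dots> \<le> B * norm x" by (simp add: B_def sum_distrib_left distrib_left mult.commute)
    finally show ?thesis .
  qed
  have "B-lipschitz_on UNIV N"
  proof (rule lipschitz_onI)
    fix x y
    have "N x \<le> N y + N (x - y)" "N y \<le> N x + N (y - x)" using N(4)[of y "x - y"] N(4)[of x "y - x"] by simp_all
    then show "dist (N x) (N y) \<le> B * dist x y"
      using B[of "x - y"] B[of "y - x"] by (simp add: dist_norm norm_minus_commute abs_le_iff)
  qed (use B0 in simp)
  then have "continuous_on (sphere 0 1) N"
    using lipschitz_on_continuous_on continuous_on_subset by blast
  moreover have "sphere (0::'a) 1 \<noteq> {}" by simp
  ultimately obtain z where z: "z \<in> sphere 0 1" "\<And>x. x \<in> sphere 0 1 \<Longrightarrow> N z \<le> N x"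
    using continuous_attains_inf[OF compact_sphere] by blast
  have "z \<noteq> 0" using z(1) by auto
  then have Nz: "N z > 0" using N(1)[of z] N(2)[of z] by simp
  have "norm x \<le> 1 / N z * N x" for x
  proof (cases "x = 0")
    case False
    then have "N z \<le> N (x /\<^sub>R norm x)" by (intro z(2)) simp
    then have "N z \<le> N x / norm x" by (simp add: N(3) divide_inverse mult.commute)
    then show ?thesis using Nz False by (simp add: field_simps)
  qed (use N(2)[of 0] in simp)
  then show thesis using that[of "1 / N z" B] Nz B0 B by simp
qed

lemma cross3_axis: "cross3 (axis i 1) (axis (i + 1) 1) = axis (i - 1) 1"
proof -
  have e: "(1::3) + 1 = 2" "(2::3) + 1 = 3" "(3::3) + 1 = 1" "(1::3) - 1 = 3" "(2::3) - 1 = 1" "(3::3) - 1 = 2"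
    by simp_all
  show ?thesis using exhaust_3[of i] by (elim disjE) (simp_all only: e cross_basis)
qed

theorem mainTheorem4:
  fixes U :: "(real^15) set"
    and \<sigma> :: "real^15 \<Rightarrow> frames"
    and p :: "real^15"
    and g :: "real^15 \<Rightarrow> real^15^15"
    and N :: "real^15 \<Rightarrow> real"
  assumes "quotient_coordinates U \<sigma>"
    and "p \<in> U" and "quot_class (\<sigma> p) = SO3_orbit O6"
    and "riemannian_metric U g"
    and "is_norm N"
  shows "\<exists>L. subspace L \<and> dim L = 6 \<and>
    (\<exists>c\<^sub>d c\<^sub>u. 0 < c\<^sub>d \<and> c\<^sub>d \<le> c\<^sub>u \<and>
      (\<forall>l\<in>L. N l = 1 \<longrightarrow>
        (\<forall>\<^sub>F t in at_right (0::real).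
          - c\<^sub>u * N l * t\<^sup>2
            \<le> D_quot (quot_class (\<sigma> (exp_map U g p (t *\<^sub>R l)))) - D_quot (SO3_orbit O6) \<and>
          D_quot (quot_class (\<sigma> (exp_map U g p (t *\<^sub>R l)))) - D_quot (SO3_orbit O6)
            \<le> - c\<^sub>d * N l * t\<^sup>2))) \<and>
    (\<forall>l. l \<notin> L \<longrightarrow>
      (\<exists>c\<^sub>d' c\<^sub>u'. 0 < c\<^sub>d' \<and> c\<^sub>d' \<le> c\<^sub>u' \<and>
        (\<forall>\<^sub>F t in at_right (0::real).
          - c\<^sub>u' * t
            \<le> D_quot (quot_class (\<sigma> (exp_map U g p (t *\<^sub>R l)))) - D_quot (SO3_orbit O6) \<and>
          D_quot (quot_class (\<sigma> (exp_map U g p (t *\<^sub>R l)))) - D_quot (SO3_orbit O6)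
            \<le> - c\<^sub>d' * t)))"
proof -
  have U: "open U" and smooth: "Ck_on n \<sigma> U" and unit: "\<And>u. u \<in> U \<Longrightarrow> \<sigma> u \<in> unit_frames"
    and immersion: "\<And>h. frechet_derivative \<sigma> (at p) h \<in> orbit_tangent (\<sigma> p) \<Longrightarrow> h = 0" for n
    using assms(1,2) by (auto simp: quotient_coordinates_def smooth_on_def)
  have "rotate_config (mat 1) (config_of (\<sigma> p)) \<in> quot_class (\<sigma> p)"
    unfolding quot_class_def SO3_orbit_def by (auto simp: rotation_matrix_def orthogonal_matrix_id)
  moreover have "rotate_config (mat 1) (config_of (\<sigma> p)) = config_of (\<sigma> p)"
    by (simp add: rotate_config_def)
  ultimately obtain R where R: "rotation_matrix R" "config_of (\<sigma> p) = rotate_config R O6"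
    unfolding assms(3) SO3_orbit_def by auto
  define f where "f i = R *v axis i 1" for i
  have Rinner: "(R *v x) \<bullet> (R *v y) = x \<bullet> y" for x y
    using R(1) by (simp add: rotation_matrix_def orthogonal_transformation_matrix orthogonal_transformation_def)
      (metis orthogonal_transformation_def orthogonal_transformation_matrix matrix_of_matrix_vector_mul matrix_vector_mul_linear)
  have f_inner: "f i \<bullet> f j = (if i = j then 1 else 0)" for i j
    by (simp add: f_def Rinner inner_axis_axis)
  have f_cross: "cross3 (f i) (f (i + 1)) = f (i - 1)" for i
    by (simp add: f_def cross_rotation_matrix[OF R(1)] cross3_axis)
  \<comment> \<open>The rotation \<open>R\<close> carries \<open>O6\<close> to the configuration at \<open>p\<close>; the frames at \<open>p\<close> are recovered from
    their lines.\<close>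
  have frame_p: "fst (\<sigma> p $ k) = sgn_of (snd k) *\<^sub>R f (fst k) \<and>
      (snd (\<sigma> p $ k) = f (fst k - 1) \<or> snd (\<sigma> p $ k) = - f (fst k - 1))" for k
  proof -
    obtain i \<epsilon> where k: "k = (i, \<epsilon>)" by (cases k)
    have "tangent_line (\<sigma> p $ k) = (*v) R ` O6 k"
      using fun_cong[OF R(2), of k] by (simp add: config_of_def rotate_config_def)
    also have "\<dots> = tangent_line (sgn_of \<epsilon> *\<^sub>R f i, f (i - 1))"
      by (simp add: k O6_def tangent_line_rotate matrix_vector_mult_scaleR f_def del: scaleR_minus1_left)
    finally have eq: "tangent_line (sgn_of \<epsilon> *\<^sub>R f i, f (i - 1)) = tangent_line (fst (\<sigma> p $ k), snd (\<sigma> p $ k))"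
      by simp
    have u1: "(sgn_of \<epsilon> *\<^sub>R f i, f (i - 1)) \<in> unit_tangent"
      by (simp add: unit_tangent_def norm_eq_1 f_inner)
    have u2: "(fst (\<sigma> p $ k), snd (\<sigma> p $ k)) \<in> unit_tangent"
      using unit[OF assms(2)] unfolding unit_frames_def prod.collapse by blast
    show ?thesis
      using tangent_line_inject[OF u1 u2 eq] unfolding k fst_conv snd_conv by metis
  qed
  \<comment> \<open>The lines at \<open>p\<close> determine the directions of the frames only up to sign, which \<open>s\<close> corrects.\<close>
  define s :: "index \<Rightarrow> real" where "s k = (if snd (\<sigma> p $ k) = f (fst k - 1) then 1 else -1)" for k
  have s: "snd (\<sigma> p $ k) = s k *\<^sub>R f (fst k - 1)" "s k * s k = 1" "s k \<noteq> 0" for k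
    using frame_p[of k] by (auto simp: s_def)
  define Z where "Z v = \<sigma> (exp_map U g p v)" for v
  define Z' where "Z' = frechet_derivative \<sigma> (at p)"
  note exp = exp_map_approx[OF assms(4) U assms(2)]
  have Z_approx: "quad_approx Z Z'"
    unfolding Z_def[abs_def] Z'_def
    using quad_approx_compose[OF exp(1), of \<sigma> "frechet_derivative \<sigma> (at p)"]
      quad_approx_C2[OF smooth U assms(2)] by (simp add: exp(2))
  have Z_0: "Z 0 = \<sigma> p" by (simp add: Z_def exp(2))
  define X X' where "X k v = sgn_of (snd k) *\<^sub>R fst (Z v $ k)"
    and "X' k l = sgn_of (snd k) *\<^sub>R fst (Z' l $ k)" for k :: index and v l
  define \<Xi> \<Xi>' where "\<Xi> k v = s k *\<^sub>R snd (Z v $ k)"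
    and "\<Xi>' k l = s k *\<^sub>R snd (Z' l $ k)" for k and v l
  interpret octahedral_family f X \<Xi> X' \<Xi>'
  proof
    fix k
    have "bounded_linear (\<lambda>z :: frames. sgn_of (snd k) *\<^sub>R fst (z $ k))"
      by (intro bounded_linear_compose[OF bounded_linear_scaleR_right]
          bounded_linear_compose[OF bounded_linear_fst] bounded_linear_vec_nth)
    from quad_approx_bounded_linear[OF this Z_approx]
    show "quad_approx (X k) (X' k)" by (simp only: X_def[abs_def] X'_def[abs_def])
    have "bounded_linear (\<lambda>z :: frames. s k *\<^sub>R snd (z $ k))"
      by (intro bounded_linear_compose[OF bounded_linear_scaleR_right]
          bounded_linear_compose[OF bounded_linear_snd] bounded_linear_vec_nth)
    from quad_approx_bounded_linear[OF this Z_approx]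
    show "quad_approx (\<Xi> k) (\<Xi>' k)" by (simp only: \<Xi>_def[abs_def] \<Xi>'_def[abs_def])
    show "X k 0 = f (fst k)" using frame_p[of k] by (simp add: X_def Z_0)
    show "\<Xi> k 0 = f (fst k - 1)" using s[of k] by (simp add: \<Xi>_def Z_0)
  next
    show "\<forall>\<^sub>F v in nhds 0. \<forall>k. norm (X k v) = 1 \<and> norm (\<Xi> k v) = 1 \<and> X k v \<bullet> \<Xi> k v = 0"
      using exp(3)
    proof eventually_elim
      case (elim v)
      have "\<bar>s k\<bar> = 1" for k by (simp add: s_def)
      moreover have "Z v $ k \<in> unit_tangent" for k
        using unit[OF elim] unfolding Z_def unit_frames_def by blast
      ultimately show ?case
        by (auto simp: X_def \<Xi>_def unit_tangent_def case_prod_beta)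
    qed
  next
    fix l \<omega>
    assume *: "\<And>k. X' k l = cross3 \<omega> (f (fst k)) \<and> \<Xi>' k l = cross3 \<omega> (f (fst k - 1))"
    have "Z' l $ k = (cross3 \<omega> (fst (\<sigma> p $ k)), cross3 \<omega> (snd (\<sigma> p $ k)))" for k
    proof (rule prod_eqI)
      have "sgn_of (snd k) *\<^sub>R X' k l = fst (Z' l $ k)" by (simp add: X'_def)
      then show "fst (Z' l $ k) = fst (cross3 \<omega> (fst (\<sigma> p $ k)), cross3 \<omega> (snd (\<sigma> p $ k)))"
        using *[of k] frame_p[of k] by (simp add: cross_mult_right del: scaleR_minus1_left)
      have "s k *\<^sub>R \<Xi>' k l = snd (Z' l $ k)" by (simp add: \<Xi>'_def s)
      then show "snd (Z' l $ k) = snd (cross3 \<omega> (fst (\<sigma> p $ k)), cross3 \<omega> (snd (\<sigma> p $ k)))"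
        using *[of k] by (simp add: s(1) cross_mult_right)
    qed
    then have "Z' l \<in> orbit_tangent (\<sigma> p)"
      unfolding orbit_tangent_def by (auto simp: vec_eq_iff intro!: exI[of _ \<omega>])
    then show "l = 0" using immersion by (simp add: Z'_def)
  qed (use f_inner f_cross in auto)
  have lines: "lines v = config_of (Z v)" for v
  proof
    fix k
    have "lines v k = tangent_line (fst (Z v $ k), s k *\<^sub>R snd (Z v $ k))"
      by (simp add: lines_def X_def \<Xi>_def)
    then show "lines v k = config_of (Z v) k"
      by (simp add: config_of_def tangent_line_scale s(3))
  qed
  have D: "D_quot (quot_class (\<sigma> (exp_map U g p v))) = D_tilde (lines v)" for v
    by (simp add: lines D_quot_quot_class Z_def)
  have D0: "D_quot (SO3_orbit O6) = 1"
    using D[of 0] D_tilde_lines_0 by (simp add: exp(2) assms(3))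
  obtain A B where AB: "A > 0" "B > 0" "\<And>x. N x \<le> B * norm x" "\<And>x. norm x \<le> A * N x"
    using is_norm_equivalent[OF assms(5)] by blast
  obtain C where C: "C \<ge> 0"
    "\<And>l. l \<in> L \<Longrightarrow> \<forall>\<^sub>F t in at_right 0. - C * (norm l)\<^sup>2 * t\<^sup>2 \<le> D_tilde (lines (t *\<^sub>R l)) - 1"
    using D_tilde_quadratic_lower by blast
  obtain m where m: "m > 0"
    "\<And>l. l \<in> L \<Longrightarrow> l \<noteq> 0 \<Longrightarrow> \<forall>\<^sub>F t in at_right 0. D_tilde (lines (t *\<^sub>R l)) - 1 \<le> - m * (norm l)\<^sup>2 * t\<^sup>2"
    using D_tilde_quadratic_upper by blast
  define c\<^sub>d where "c\<^sub>d = m / B\<^sup>2"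
  define c\<^sub>u where "c\<^sub>u = max c\<^sub>d (C * A\<^sup>2)"
  have "\<forall>\<^sub>F t in at_right 0. - c\<^sub>u * N l * t\<^sup>2 \<le> D_tilde (lines (t *\<^sub>R l)) - 1 \<and>
      D_tilde (lines (t *\<^sub>R l)) - 1 \<le> - c\<^sub>d * N l * t\<^sup>2" if l: "l \<in> L" "N l = 1" for l
  proof -
    have "l \<noteq> 0" using AB(3)[of l] l(2) by auto
    have "1 \<le> (B * norm l)\<^sup>2" using AB(3)[of l] l(2) by (simp add: one_le_power)
    then have "c\<^sub>d \<le> m * (norm l)\<^sup>2"
      using m(1) AB(2) by (simp add: c\<^sub>d_def field_simps power_mult_distrib)
    moreover have "(norm l)\<^sup>2 \<le> A\<^sup>2" using AB(4)[of l] l(2) by (intro power_mono) auto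
    then have "C * (norm l)\<^sup>2 \<le> c\<^sub>u" using C(1) by (simp add: c\<^sub>u_def le_max_iff_disj mult_left_mono)
    ultimately have le: "c\<^sub>d * t\<^sup>2 \<le> m * (norm l)\<^sup>2 * t\<^sup>2" "C * (norm l)\<^sup>2 * t\<^sup>2 \<le> c\<^sub>u * t\<^sup>2" for t
      by (auto intro: mult_right_mono)
    show ?thesis using C(2)[OF l(1)] m(2)[OF l(1) \<open>l \<noteq> 0\<close>]
    proof eventually_elim
      case (elim t)
      then show ?case using le[of t] l(2) by simp
    qed
  qed
  moreover have "0 < c\<^sub>d" "c\<^sub>d \<le> c\<^sub>u" using m(1) AB(2) by (simp_all add: c\<^sub>d_def c\<^sub>u_def)
  ultimately show ?thesis
    unfolding D D0
    using subspace_L dim_L D_tilde_linear_decay by (intro exI[of _ L]) blast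
qed

end
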